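(* For every integer $k \geq 8$ and every integer $m \geq 1$, \[ H(k+m, k) \cap \left\{ \tfrac{15}{16} 2^{k-1}, \tfrac{15}{16} 2^{k-1}+1, \dots, 2^{k-1}\right\}= \left\{ \tfrac{15}{16} 2^{k-1}, \tfrac{126}{128} 2^{k-1}, 2^{k-1} \right\}. \]
   Context: Let $\mathbb{H}^n=\{0,1\}^n\subseteq\mathbb{R}^n$. For $n\geq k$, $H(n,k)$ is the set of all possible sizes $|S\cap \mathbb{H}^n|$ where $S$ ranges over $k$-dimensional linear subspaces of $\mathbb{R}^n$; equivalently, $H(n,k)=\{\,|\mathbb{H}^k\cap L^{-1}(\mathbb{H}^{n-k})| : L:\mathbb{R}^k\to\mathbb{R}^{n-k}\text{ linear}\,\}$. The set $\{\tfrac{15}{16}2^{k-1},\dots,2^{k-1}\}$ denotes the integers from $\tfrac{15}{16}2^{k-1}$ to $2^{k-1}$ inclusive. *)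

theory Defs
  imports "HOL-Analysis.Analysis"
begin

text \<open>Points of R^k are modelled as functions nat => real vanishing outside {0..<k}.
  The Boolean cube H^k = {0,1}^k inside R^k.\<close>
definition cube :: "nat \<Rightarrow> (nat \<Rightarrow> real) set" where
  "cube k = {x. (\<forall>i<k. x i = 0 \<or> x i = 1) \<and> (\<forall>i\<ge>k. x i = 0)}"

text \<open>A linear map L : R^k -> R^(n-k) is given by its (n-k) x k real matrix A:
  (L x)_i = sum_{j<k} A i j * x j.  H(n,k) is the set of all values
  |H^k \<inter> L^{-1}(H^(n-k))|.\<close>
definition Hset :: "nat \<Rightarrow> nat \<Rightarrow> nat set" where
  "Hset n k = {card {x \<in> cube k. \<forall>i < n - k.
                  (\<Sum>j<k. A i j * x j) = 0 \<or> (\<Sum>j<k. A i j * x j) = 1}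
               | A :: nat \<Rightarrow> nat \<Rightarrow> real. True}"

end

(*
Write x = (1 + w)/2 and homogenise: a row a becomes the row b = (a, sum a - 1) on one more
coordinate, and "a.x is 0 or 1" becomes |b.z| = 1 for a sign vector z, a condition invariant
under z -> -z. The density 15/32, 63/128 or 1/2 is then the probability that a uniform z
satisfies all rows.

A row with a coefficient other than 0, 1, -1 has probability at most 1/2, because flipping that
sign destroys the condition; more precisely it is 15/32 or less as soon as six coordinates are
involved, since five nonzero summands produce a chain of six values of which four are allowed. A
satisfiable row with entries 0, 1, -1 has an odd support of size n and probability C(n,
(n-1)/2)/2^(n-1), which leaves n = 3, 5, 7, 9 (rows with n = 1 always hold). Two principles
control the combination of several rows. If all rows together involve at most d + 1 coordinates,
the probability is a multiple of 1/2^d. If a further row has two coordinates outside the supports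
of the previous ones, it costs a factor 3/4. The remaining configurations overlap heavily. A row
of size 7 or 9 combined with any other row yields at most 15/32; for two rows of the same size
this is an AM-GM estimate, and for a row of size 3 it follows by writing its indicator as half
the sum of three indicators "two signs are opposed". Rows of size 3 that pairwise share two
coordinates either live on four coordinates or share a common pair, in which case the event that
this pair is opposed, of probability 1/2, satisfies all of them unless two rows have conflicting
signs there and together already have probability at most 1/2.
*)
theory Submission
  imports Defs
begin

subsection \<open>Uniform sign vectors\<close>

text \<open>For finite \<open>I\<close>, the expectation of \<open>f\<close> over a uniformly random
  subset; kept as a finite sum so that conditioning on coordinates is elementary.\<close>

definition avg :: "'a set \<Rightarrow> ('a set \<Rightarrow> real) \<Rightarrow> real" where
  "avg I f = (\<Sum>X\<in>Pow I. f X) / 2 ^ card I"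

abbreviation prob_on :: "'a set \<Rightarrow> ('a set \<Rightarrow> bool) \<Rightarrow> real" where
  "prob_on I Q \<equiv> avg I (\<lambda>X. of_bool (Q X))"

text \<open>A sign vector is encoded by the set \<open>X\<close> of coordinates at which it is \<open>1\<close>.\<close>
definition sg :: "'a set \<Rightarrow> 'a \<Rightarrow> real" where
  "sg X j = (if j \<in> X then 1 else -1)"

definition rsum :: "'a set \<Rightarrow> ('a \<Rightarrow> real) \<Rightarrow> 'a set \<Rightarrow> real" where
  "rsum I b X = (\<Sum>j\<in>I. b j * sg X j)"

definition row_ok :: "'a set \<Rightarrow> ('a \<Rightarrow> real) \<Rightarrow> 'a set \<Rightarrow> bool" where
  "row_ok I b X \<longleftrightarrow> \<bar>rsum I b X\<bar> = 1"

definition good :: "'a set \<Rightarrow> ('a \<Rightarrow> real) set \<Rightarrow> 'a set \<Rightarrow> bool" where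
  "good I R X \<longleftrightarrow> (\<forall>b\<in>R. row_ok I b X)"

definition supp :: "'a set \<Rightarrow> ('a \<Rightarrow> real) \<Rightarrow> 'a set" where
  "supp I b = {j\<in>I. b j \<noteq> 0}"

definition unit_row :: "'a set \<Rightarrow> ('a \<Rightarrow> real) \<Rightarrow> bool" where
  "unit_row I b \<longleftrightarrow> (\<forall>j\<in>I. b j = 0 \<or> \<bar>b j\<bar> = 1)"

section \<open>Calculus of expectations over independent signs\<close>

lemma avg_mono: "(\<And>X. X \<subseteq> I \<Longrightarrow> f X \<le> g X) \<Longrightarrow> avg I f \<le> avg I g"
  unfolding avg_def by (intro divide_right_mono sum_mono) auto

lemma avg_cong: "(\<And>X. X \<subseteq> I \<Longrightarrow> f X = g X) \<Longrightarrow> avg I f = avg I g"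
  unfolding avg_def by (metis (mono_tags, lifting) Pow_iff sum.cong)

lemma avg_add: "avg I (\<lambda>X. f X + g X) = avg I f + avg I g"
  unfolding avg_def by (simp add: sum.distrib add_divide_distrib)

lemma avg_cmult: "avg I (\<lambda>X. c * f X) = c * avg I f"
  unfolding avg_def by (simp add: sum_distrib_left)

lemma avg_const: "finite I \<Longrightarrow> avg I (\<lambda>X. c) = c"
  unfolding avg_def by (simp add: card_Pow)

lemma avg_empty [simp]: "avg {} f = f {}"
  by (simp add: avg_def)

lemma avg_insert:
  assumes "finite I" "i \<notin> I"
  shows "avg (insert i I) f = avg I (\<lambda>X. (f X + f (insert i X)) / 2)"
proof -
  have inj: "inj_on (insert i) (Pow I)"
    using assms(2) by (auto simp: inj_on_def)
  have "(\<Sum>X\<in>Pow (insert i I). f X) = (\<Sum>X\<in>Pow I. f X) + (\<Sum>X\<in>insert i ` Pow I. f X)"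
    unfolding Pow_insert using assms by (intro sum.union_disjoint) auto
  also have "(\<Sum>X\<in>insert i ` Pow I. f X) = (\<Sum>X\<in>Pow I. f (insert i X))"
    using inj by (simp add: sum.reindex)
  finally show ?thesis
    using assms unfolding avg_def
    by (simp add: sum.distrib sum_divide_distrib[symmetric])
qed

text \<open>Fubini for two disjoint blocks of coordinates, by adding the elements of
  \<open>W\<close> one at a time.\<close>

lemma avg_Un:
  assumes "finite W" "finite M" "M \<inter> W = {}"
  shows "avg (M \<union> W) f = avg M (\<lambda>Y. avg W (\<lambda>Z. f (Y \<union> Z)))"
  using assms
proof (induction W arbitrary: f rule: finite_induct)
  case empty
  then show ?case by simp
next
  case (insert w W)
  have "avg (M \<union> insert w W) f = avg (M \<union> W) (\<lambda>X. (f X + f (insert w X)) / 2)"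
    using insert by (simp add: avg_insert)
  also have "\<dots> = avg M (\<lambda>Y. avg W (\<lambda>Z. (f (Y \<union> Z) + f (insert w (Y \<union> Z))) / 2))"
    using insert by simp
  also have "\<dots> = avg M (\<lambda>Y. avg (insert w W) (\<lambda>Z. f (Y \<union> Z)))"
    using insert by (simp add: avg_insert)
  finally show ?case .
qed

lemma avg_diff:
  assumes "finite I" "W \<subseteq> I"
  shows "avg I f = avg (I - W) (\<lambda>Y. avg W (\<lambda>Z. f (Y \<union> Z)))"
proof -
  have "avg ((I - W) \<union> W) f = avg (I - W) (\<lambda>Y. avg W (\<lambda>Z. f (Y \<union> Z)))"
    using assms by (intro avg_Un) (auto intro: finite_subset)
  moreover have "(I - W) \<union> W = I" using assms by blast
  ultimately show ?thesis by simp
qed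

lemma avg_diff1:
  assumes "finite I" "i \<in> I"
  shows "avg I f = avg (I - {i}) (\<lambda>X. (f X + f (insert i X)) / 2)"
  using avg_insert[of "I - {i}" i f] assms by (simp add: insert_absorb)

text \<open>By Fubini the inner average over \<open>I - M\<close> is the average of a
  constant.\<close>

lemma avg_local:
  assumes "finite I" "M \<subseteq> I" "\<And>X. X \<subseteq> I \<Longrightarrow> f X = f (X \<inter> M)"
  shows "avg I f = avg M f"
proof -
  have fin: "finite (I - M)" "finite M"
    using assms by (auto intro: finite_subset)
  have "avg (M \<union> (I - M)) f = avg M (\<lambda>Y. avg (I - M) (\<lambda>Z. f (Y \<union> Z)))"
    using fin by (intro avg_Un) auto
  also have "\<dots> = avg M (\<lambda>Y. avg (I - M) (\<lambda>Z. f Y))"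
  proof (intro avg_cong)
    fix Y Z assume YZ: "Y \<subseteq> M" "Z \<subseteq> I - M"
    then have "(Y \<union> Z) \<inter> M = Y" by blast
    then show "f (Y \<union> Z) = f Y"
      using assms(3)[of "Y \<union> Z"] YZ assms(2) by (metis Diff_subset Un_least order_trans)
  qed
  also have "\<dots> = avg M f"
    using fin by (simp add: avg_const)
  finally show ?thesis
    using assms(2) by (simp add: Un_absorb1)
qed

lemma prob_on_mono: "(\<And>X. X \<subseteq> I \<Longrightarrow> P X \<Longrightarrow> Q X) \<Longrightarrow> prob_on I P \<le> prob_on I Q"
  by (intro avg_mono) auto

text \<open>A point of \<open>Q\<close> outside \<open>P\<close> would make the finite sum for
  \<open>P\<close> strictly smaller, so nested events of equal probability coincide.\<close>

lemma prob_on_eq_imp: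
  assumes "finite I" "\<And>X. X \<subseteq> I \<Longrightarrow> P X \<Longrightarrow> Q X" "prob_on I P = prob_on I Q"
    and "X \<subseteq> I" "Q X"
  shows "P X"
proof (rule ccontr)
  assume "\<not> P X"
  then have "(\<Sum>X\<in>Pow I. of_bool (P X) :: real) < (\<Sum>X\<in>Pow I. of_bool (Q X))"
    using assms by (intro sum_strict_mono_ex1) auto
  then show False
    using assms(3) unfolding avg_def by simp
qed

section \<open>Signed sums under splitting and complementation\<close>

lemma rsum_Un:
  assumes "finite M" "finite W" "M \<inter> W = {}" "Y \<subseteq> M" "Z \<subseteq> W"
  shows "rsum (M \<union> W) b (Y \<union> Z) = rsum M b Y + rsum W b Z"
proof -
  have "rsum (M \<union> W) b (Y \<union> Z) = rsum M b (Y \<union> Z) + rsum W b (Y \<union> Z)"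
    unfolding rsum_def using assms by (intro sum.union_disjoint) auto
  also have "rsum M b (Y \<union> Z) = rsum M b Y"
    unfolding rsum_def using assms by (intro sum.cong) (auto simp: sg_def)
  also have "rsum W b (Y \<union> Z) = rsum W b Z"
    unfolding rsum_def using assms by (intro sum.cong) (auto simp: sg_def)
  finally show ?thesis .
qed

lemma rsum_diff:
  assumes "finite I" "W \<subseteq> I" "Y \<subseteq> I - W" "Z \<subseteq> W"
  shows "rsum I b (Y \<union> Z) = rsum (I - W) b Y + rsum W b Z"
proof -
  have "rsum ((I - W) \<union> W) b (Y \<union> Z) = rsum (I - W) b Y + rsum W b Z"
    using assms by (intro rsum_Un) (auto intro: finite_subset)
  moreover have "(I - W) \<union> W = I" using assms by blast
  ultimately show ?thesis by simp
qed

lemma rsum_off: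
  assumes "finite I" "i \<in> I" "X \<subseteq> I - {i}"
  shows "rsum I b X = rsum (I - {i}) b X - b i"
  using rsum_diff[of I "{i}" X "{}" b] assms by (simp add: rsum_def sg_def)

lemma rsum_on:
  assumes "finite I" "i \<in> I" "X \<subseteq> I - {i}"
  shows "rsum I b (insert i X) = rsum (I - {i}) b X + b i"
  using rsum_diff[of I "{i}" X "{i}" b] assms by (simp add: rsum_def sg_def)

lemma rsum_supp:
  assumes "finite I" "supp I b \<subseteq> M" "M \<subseteq> I"
  shows "rsum I b X = rsum M b (X \<inter> M)"
proof -
  have "rsum I b X = rsum M b X"
    unfolding rsum_def using assms by (intro sum.mono_neutral_right) (auto simp: supp_def)
  also have "\<dots> = rsum M b (X \<inter> M)"
    unfolding rsum_def by (intro sum.cong) (auto simp: sg_def)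
  finally show ?thesis .
qed

lemma rsum_cong:
  assumes "finite I" "supp I b \<subseteq> M" "X \<inter> M = X' \<inter> M"
  shows "rsum I b X = rsum I b X'"
  unfolding rsum_def using assms by (intro sum.cong) (auto simp: supp_def sg_def)

lemma rsum_compl: "X \<subseteq> I \<Longrightarrow> rsum I b (I - X) = - rsum I b X"
  unfolding rsum_def sum_negf[symmetric] by (intro sum.cong) (auto simp: sg_def)

lemma good_cong:
  assumes "finite I" "\<Union>(supp I ` R) \<subseteq> M" "X \<inter> M = X' \<inter> M"
  shows "good I R X \<longleftrightarrow> good I R X'"
proof -
  have "rsum I b X = rsum I b X'" if "b \<in> R" for b
    using that assms by (intro rsum_cong[of _ _ M]) auto
  then show ?thesis by (simp add: good_def row_ok_def)
qed

lemma good_compl: "X \<subseteq> I \<Longrightarrow> good I R (I - X) \<longleftrightarrow> good I R X"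
  by (simp add: good_def row_ok_def rsum_compl)

text \<open>Complementation exchanges the subsets that contain \<open>i\<close> with those that do
  not, so for an invariant \<open>f\<close> the sign at one coordinate may be fixed either
  way.\<close>

lemma avg_symmetric:
  assumes "finite I" "i \<in> I" "\<And>X. X \<subseteq> I \<Longrightarrow> f (I - X) = f X"
  shows "avg I f = avg (I - {i}) f" "avg I f = avg (I - {i}) (\<lambda>X. f (insert i X))"
proof -
  let ?J = "I - {i}"
  have "(\<Sum>X\<in>Pow ?J. f (insert i X)) = (\<Sum>X\<in>Pow ?J. f X)"
  proof (rule sum.reindex_bij_witness[of _ "\<lambda>X. ?J - X" "\<lambda>X. ?J - X"])
    fix X assume "X \<in> Pow ?J"
    then have "f (I - insert i X) = f (insert i X)" "I - insert i X = ?J - X"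
      using assms(2) by (auto intro!: assms(3))
    then show "f (?J - X) = f (insert i X)" by simp
  qed auto
  then have "avg ?J (\<lambda>X. f (insert i X)) = avg ?J f"
    by (simp add: avg_def)
  moreover have "avg I f = (avg ?J f + avg ?J (\<lambda>X. f (insert i X))) / 2"
    using assms avg_cmult[of ?J "1/2" f] avg_cmult[of ?J "1/2" "\<lambda>X. f (insert i X)"]
    by (simp add: avg_diff1[of I i] add_divide_distrib avg_add)
  ultimately show "avg I f = avg ?J f" "avg I f = avg ?J (\<lambda>X. f (insert i X))" by auto
qed

text \<open>Symmetry under complement fixes one of the at most \<open>d + 1\<close> relevant signs;
  the others, at most \<open>d\<close>, have equally likely patterns.\<close>

lemma prob_good_granular:
  assumes "finite I" "card (\<Union>(supp I ` R)) \<le> Suc d"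
  shows "\<exists>n::nat. prob_on I (good I R) = n / 2 ^ d"
proof -
  let ?M = "\<Union>(supp I ` R)"
  have MI: "?M \<subseteq> I" by (auto simp: supp_def)
  then have finM: "finite ?M" using assms(1) finite_subset by blast
  have granular: "\<exists>n::nat. prob_on J Q = n / 2 ^ d" if "finite J" "card J \<le> d"
    for J :: "'a set" and Q
  proof -
    have "(\<Sum>X\<in>Pow J. of_bool (Q X)) = real (card {X\<in>Pow J. Q X})"
      using that by (simp add: Int_def flip: of_nat_sum)
    moreover have "(2::real) ^ d = 2 ^ card J * 2 ^ (d - card J)"
      using that by (simp flip: power_add)
    ultimately have "prob_on J Q = real (card {X\<in>Pow J. Q X} * 2 ^ (d - card J)) / 2 ^ d"
      by (simp add: avg_def)
    then show ?thesis by (rule exI)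
  qed
  have eq: "prob_on I (good I R) = prob_on ?M (good I R)"
  proof (rule avg_local[OF assms(1) MI])
    fix X
    have "good I R X = good I R (X \<inter> ?M)"
      by (rule good_cong[OF assms(1) order_refl]) blast
    then show "of_bool (good I R X) = (of_bool (good I R (X \<inter> ?M)) :: real)" by simp
  qed
  show ?thesis
  \<comment> \<open>Without coordinates there is no sign to fix, but the empty set already has at
    most \<open>d\<close> elements.\<close>
  proof (cases "?M = {}")
    case True
    then show ?thesis using eq granular[of ?M "good I R"] by simp
  next
    case False
    then obtain i where i: "i \<in> ?M" by blast
    have "good I R (?M - X) = good I R X" if "X \<subseteq> ?M" for X
    proof -
      have "good I R (?M - X) = good I R (I - X)"
        by (rule good_cong[OF assms(1) order_refl]) (use MI in blast)
      moreover have "X \<subseteq> I" using that MI by (rule order_trans)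
      ultimately show ?thesis using good_compl by metis
    qed
    then have "prob_on ?M (good I R) = prob_on (?M - {i}) (good I R)"
      using finM i by (intro avg_symmetric(1)) simp_all
    then show ?thesis
      using eq granular[of "?M - {i}" "good I R"] i finM assms(2) by simp
  qed
qed

text \<open>A new summand of size \<open>c > 0\<close> replaces the value set by its translates by
  \<open>c\<close> and \<open>- c\<close>. The old maximum plus \<open>c\<close> lies above the
  whole lower translate, so every summand adds at least one value.\<close>

lemma card_rsum_values:
  assumes "finite W" "\<And>j. j \<in> W \<Longrightarrow> b j \<noteq> 0"
  shows "card W + 1 \<le> card (rsum W b ` Pow W)"
  using assms
proof (induction W rule: finite_induct)
  case empty
  then show ?case by simp
next
  case (insert w W)
  let ?V = "rsum W b ` Pow W"
  define c where "c = \<bar>b w\<bar>"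
  have c: "c > 0" using insert by (simp add: c_def)
  have fin: "finite ?V" "?V \<noteq> {}" using insert by auto
  have vals: "rsum (insert w W) b ` Pow (insert w W) = (\<lambda>v. v - b w) ` ?V \<union> (\<lambda>v. v + b w) ` ?V"
  proof -
    have "rsum (insert w W) b ` Pow W = (\<lambda>v. v - b w) ` ?V"
      unfolding image_image using insert rsum_off[of "insert w W" w _ b]
      by (intro image_cong) auto
    moreover have "rsum (insert w W) b ` insert w ` Pow W = (\<lambda>v. v + b w) ` ?V"
      unfolding image_image using insert rsum_on[of "insert w W" w _ b]
      by (intro image_cong) auto
    ultimately show ?thesis by (simp add: Pow_insert image_Un)
  qed
  \<comment> \<open>The pair of translates is the same for either sign of
    \<open>b w\<close>.\<close>
  also have "\<dots> = (\<lambda>v. v - c) ` ?V \<union> (\<lambda>v. v + c) ` ?V"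
    unfolding c_def by (cases "b w \<ge> 0") (auto simp: abs_if)
  finally have eq: "rsum (insert w W) b ` Pow (insert w W) = (\<lambda>v. v - c) ` ?V \<union> (\<lambda>v. v + c) ` ?V" .
  have "Max ?V + c \<notin> (\<lambda>v. v - c) ` ?V"
  proof
    assume "Max ?V + c \<in> (\<lambda>v. v - c) ` ?V"
    then obtain v where "v \<in> ?V" "Max ?V + c = v - c" by blast
    moreover have "v \<le> Max ?V" using fin \<open>v \<in> ?V\<close> by simp
    ultimately show False using c by simp
  qed
  then have "card (insert (Max ?V + c) ((\<lambda>v. v - c) ` ?V)) = card ?V + 1"
    using fin(1) by (simp add: card_image inj_on_def)
  moreover
  have "insert (Max ?V + c) ((\<lambda>v. v - c) ` ?V) \<subseteq> (\<lambda>v. v - c) ` ?V \<union> (\<lambda>v. v + c) ` ?V"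
    using Max_in[OF fin] by blast
  then have "card (insert (Max ?V + c) ((\<lambda>v. v - c) ` ?V))
      \<le> card ((\<lambda>v. v - c) ` ?V \<union> (\<lambda>v. v + c) ` ?V)"
    by (rule card_mono[rotated]) (use fin(1) in blast)
  moreover have "card (insert w W) = card W + 1" using insert by simp
  ultimately show ?case using insert.IH insert.prems unfolding eq by force
qed

text \<open>Every value of the signed sum is taken at least once, so at least
  \<open>card W + 1 - card T\<close> of the \<open>2 ^ card W\<close> sign patterns miss
  \<open>T\<close>.\<close>

lemma prob_rsum_mem_le:
  assumes "finite W" "\<And>j. j \<in> W \<Longrightarrow> b j \<noteq> 0" "finite T"
  shows "prob_on W (\<lambda>Z. rsum W b Z \<in> T) \<le> 1 - (real (card W) + 1 - real (card T)) / 2 ^ card W"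
proof -
  let ?bad = "{Z\<in>Pow W. rsum W b Z \<notin> T}"
  have "card (rsum W b ` Pow W) - card T \<le> card (rsum W b ` Pow W - T)"
    using assms(3) by (rule diff_card_le_card_Diff)
  also have "rsum W b ` Pow W - T = rsum W b ` ?bad" by blast
  also have "card \<dots> \<le> card ?bad"
    using assms(1) by (intro card_image_le) simp
  finally have "card W + 1 - card T \<le> card ?bad"
    using card_rsum_values[of W b] assms by simp
  \<comment> \<open>Over the reals the truncated subtraction becomes a genuine bound, trivial when
    \<open>T\<close> is large.\<close>
  then have le: "real (card W + 1) - real (card T) \<le> card ?bad" by linarith
  have "(\<Sum>Z\<in>Pow W. of_bool (rsum W b Z \<in> T)) = (\<Sum>Z\<in>Pow W. 1 - of_bool (rsum W b Z \<notin> T) :: real)"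
    by (intro sum.cong) auto
  also have "\<dots> = 2 ^ card W - real (card ?bad)"
    using assms(1) by (simp add: sum_subtractf card_Pow Int_def flip: of_nat_sum)
  also have "\<dots> \<le> 2 ^ card W - (real (card W + 1) - real (card T))"
    using le by simp
  finally have "prob_on W (\<lambda>Z. rsum W b Z \<in> T) \<le> (2 ^ card W - (real (card W + 1) - real (card T))) / 2 ^ card W"
    unfolding avg_def by (intro divide_right_mono) auto
  also have "\<dots> = 1 - (real (card W) + 1 - real (card T)) / 2 ^ card W"
    by (simp add: diff_divide_distrib[of "2 ^ card W"])
  finally show ?thesis .
qed

text \<open>Given the signs outside \<open>W\<close>, the event \<open>Q\<close> is decided and the
  remaining average of \<open>f\<close> is at most \<open>c\<close>. The third hypothesis expresses
  that \<open>Q\<close> ignores the coordinates in \<open>W\<close>.\<close>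

lemma avg_le_cond:
  assumes "finite I" "W \<subseteq> I" "\<And>Y Z. Q (Y \<union> Z) = Q Y \<or> \<not> Z \<subseteq> W"
    and "\<And>Y. Y \<subseteq> I - W \<Longrightarrow> avg W (\<lambda>Z. f (Y \<union> Z)) \<le> c"
  shows "avg I (\<lambda>X. of_bool (Q X) * f X) \<le> c * prob_on I Q"
proof -
  have "avg I (\<lambda>X. of_bool (Q X) * f X)
      = avg (I - W) (\<lambda>Y. avg W (\<lambda>Z. of_bool (Q (Y \<union> Z)) * f (Y \<union> Z)))"
    by (intro avg_diff assms)
  also have "\<dots> = avg (I - W) (\<lambda>Y. of_bool (Q Y) * avg W (\<lambda>Z. f (Y \<union> Z)))"
  proof (intro avg_cong)
    fix Y
    have "avg W (\<lambda>Z. of_bool (Q (Y \<union> Z)) * f (Y \<union> Z)) = avg W (\<lambda>Z. of_bool (Q Y) * f (Y \<union> Z))"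
    proof (intro avg_cong)
      fix Z assume "Z \<subseteq> W"
      then have "Q (Y \<union> Z) = Q Y" using assms(3)[of Y Z] by blast
      then show "of_bool (Q (Y \<union> Z)) * f (Y \<union> Z) = of_bool (Q Y) * f (Y \<union> Z)" by simp
    qed
    then show "avg W (\<lambda>Z. of_bool (Q (Y \<union> Z)) * f (Y \<union> Z)) = of_bool (Q Y) * avg W (\<lambda>Z. f (Y \<union> Z))"
      by (simp only: avg_cmult)
  qed
  also have "\<dots> \<le> avg (I - W) (\<lambda>Y. c * of_bool (Q Y))"
    using assms(4) by (intro avg_mono) auto
  also have "\<dots> = c * prob_on (I - W) Q"
    by (rule avg_cmult)
  also have "prob_on (I - W) Q = prob_on I Q"
  proof (rule avg_local[symmetric])
    fix X assume X: "X \<subseteq> I"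
    have "Q (X \<inter> (I - W) \<union> X \<inter> W) = Q (X \<inter> (I - W))"
      using assms(3)[of "X \<inter> (I - W)" "X \<inter> W"] by blast
    moreover have "X \<inter> (I - W) \<union> X \<inter> W = X" using X by blast
    ultimately show "of_bool (Q X) = (of_bool (Q (X \<inter> (I - W))) :: real)" by simp
  qed (use assms in auto)
  finally show ?thesis .
qed

text \<open>Two nonzero summands outside \<open>M\<close> produce at least three sums, only two of
  which are admissible. So for any choice of the other signs at least one of the four patterns
  fails.\<close>

lemma prob_two_outside_le:
  assumes "finite I" "card (supp I b - M) \<ge> 2" "\<And>X X'. X \<inter> M = X' \<inter> M \<Longrightarrow> Q X = Q X'"
  shows "prob_on I (\<lambda>X. Q X \<and> row_ok I b X) \<le> 3/4 * prob_on I Q"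
proof -
  obtain W where W: "W \<subseteq> supp I b - M" "card W = 2" "finite W"
    using obtain_subset_with_card_n[OF assms(2)] by (metis card.infinite zero_neq_numeral)
  then have WI: "W \<subseteq> I" by (auto simp: supp_def)
  have "avg I (\<lambda>X. of_bool (Q X) * of_bool (row_ok I b X)) \<le> 3/4 * prob_on I Q"
  proof (rule avg_le_cond[OF assms(1) WI])
    fix Y Z
    show "Q (Y \<union> Z) = Q Y \<or> \<not> Z \<subseteq> W"
      using W(1) by (auto intro!: assms(3))
  next
    fix Y assume Y: "Y \<subseteq> I - W"
    define t where "t = rsum (I - W) b Y"
    have "prob_on W (\<lambda>Z. row_ok I b (Y \<union> Z)) = prob_on W (\<lambda>Z. rsum W b Z \<in> {1 - t, -1 - t})"
      using rsum_diff[OF assms(1) WI Y]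
      by (intro avg_cong) (auto simp: row_ok_def t_def)
    also have "\<dots> \<le> 1 - (real (card W) + 1 - real (card {1 - t, -1 - t})) / 2 ^ card W"
      using W by (intro prob_rsum_mem_le) (auto simp: supp_def)
    also have "\<dots> = 3/4" using W by simp
    finally show "prob_on W (\<lambda>Z. row_ok I b (Y \<union> Z)) \<le> 3/4" .
  qed
  then show ?thesis by (simp add: of_bool_conj)
qed

subsection \<open>The law of a single row\<close>

text \<open>Expectation of \<open>F\<close> at the sum of \<open>n\<close> independent uniform
  signs: with \<open>i\<close> positive signs the sum is \<open>2 i - n\<close>.\<close>

definition binavg :: "nat \<Rightarrow> (real \<Rightarrow> real) \<Rightarrow> real" where
  "binavg n F = (\<Sum>i\<le>n. real (n choose i) * F (2 * real i - real n)) / 2 ^ n"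

text \<open>Pascal's rule, read as conditioning on the last sign.\<close>

lemma binavg_Suc: "binavg (Suc n) F = binavg n (\<lambda>s. (F (s - 1) + F (s + 1)) / 2)"
proof -
  have "(\<Sum>i\<le>Suc n. real (Suc n choose i) * F (2 * real i - real (Suc n)))
      = F (- real (Suc n)) + (\<Sum>i\<le>n. real (Suc n choose Suc i) * F (2 * real (Suc i) - real (Suc n)))"
    by (subst sum.atMost_Suc_shift) simp
  also have "(\<Sum>i\<le>n. real (Suc n choose Suc i) * F (2 * real (Suc i) - real (Suc n)))
      = (\<Sum>i\<le>n. real (n choose i) * F (2 * real i - real n + 1))
        + (\<Sum>i\<le>n. real (n choose Suc i) * F (2 * real (Suc i) - real n - 1))"
    by (simp add: sum.distrib[symmetric] algebra_simps)
  also have "F (- real (Suc n)) + ((\<Sum>i\<le>n. real (n choose i) * F (2 * real i - real n + 1))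
        + (\<Sum>i\<le>n. real (n choose Suc i) * F (2 * real (Suc i) - real n - 1)))
      = (\<Sum>i\<le>n. real (n choose i) * F (2 * real i - real n + 1))
        + (\<Sum>i\<le>Suc n. real (n choose i) * F (2 * real i - real n - 1))"
    by (subst sum.atMost_Suc_shift[of _ n]) (simp add: minus_diff_commute)
  \<comment> \<open>The top term carries the coefficient \<open>n choose Suc n\<close>, which is
    zero.\<close>
  also have "(\<Sum>i\<le>Suc n. real (n choose i) * F (2 * real i - real n - 1))
      = (\<Sum>i\<le>n. real (n choose i) * F (2 * real i - real n - 1))"
    by simp
  finally show ?thesis
    unfolding binavg_def
    by (simp add: sum.distrib[symmetric] sum_divide_distrib algebra_simps)
qed

lemma avg_rsum_units:
  assumes "finite W" "\<And>j. j \<in> W \<Longrightarrow> \<bar>b j\<bar> = 1"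
  shows "avg W (\<lambda>Z. F (rsum W b Z)) = binavg (card W) F"
  using assms
proof (induction W arbitrary: F rule: finite_induct)
  case empty
  then show ?case by (simp add: binavg_def rsum_def)
next
  case (insert w W)
  have "avg (insert w W) (\<lambda>Z. F (rsum (insert w W) b Z))
      = avg W (\<lambda>Z. (F (rsum W b Z - b w) + F (rsum W b Z + b w)) / 2)"
    using insert.hyps rsum_off[of "insert w W" w _ b] rsum_on[of "insert w W" w _ b]
    by (subst avg_insert) (auto intro!: avg_cong)
  \<comment> \<open>The sign of \<open>b w\<close> only swaps the two terms.\<close>
  also have "\<dots> = avg W (\<lambda>Z. (F (rsum W b Z - 1) + F (rsum W b Z + 1)) / 2)"
  proof -
    have "b w = 1 \<or> b w = -1" using insert.prems[of w] by (auto simp: abs_if split: if_splits)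
    then show ?thesis by (auto simp: add.commute)
  qed
  also have "\<dots> = binavg (card W) (\<lambda>s. (F (s - 1) + F (s + 1)) / 2)"
    using insert.IH[of "\<lambda>s. (F (s - 1) + F (s + 1)) / 2"] insert.prems by simp
  also have "\<dots> = binavg (card (insert w W)) F"
    using insert.hyps by (simp add: binavg_Suc)
  finally show ?case .
qed

lemma unit_row_abs: "unit_row I b \<Longrightarrow> j \<in> supp I b \<Longrightarrow> \<bar>b j\<bar> = 1"
  by (auto simp: unit_row_def supp_def)

text \<open>Uniform signs absorb the signs of the coefficients, so only the size of the support
  matters.\<close>

lemma avg_rsum_unit_row:
  assumes "finite I" "unit_row I b"
  shows "avg I (\<lambda>X. F (rsum I b X)) = binavg (card (supp I b)) F"
proof -
  have "supp I b \<subseteq> I" by (auto simp: supp_def)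
  then have "finite (supp I b)" using assms(1) finite_subset by blast
  have "avg I (\<lambda>X. F (rsum I b X)) = avg (supp I b) (\<lambda>X. F (rsum I b X))"
  proof (rule avg_local[OF assms(1) \<open>supp I b \<subseteq> I\<close>])
    show "F (rsum I b X) = F (rsum I b (X \<inter> supp I b))" for X
      by (intro arg_cong[where f = F] rsum_cong[OF assms(1) order_refl]) blast
  qed
  also have "\<dots> = avg (supp I b) (\<lambda>X. F (rsum (supp I b) b X))"
    using rsum_supp[OF assms(1) order_refl \<open>supp I b \<subseteq> I\<close>]
    by (intro avg_cong) (metis Int_absorb2)
  also have "\<dots> = binavg (card (supp I b)) F"
    using \<open>finite (supp I b)\<close> assms(2) unit_row_abs by (intro avg_rsum_units) auto
  finally show ?thesis .
qed

text \<open>The sums move in steps of 2, so at most two consecutive indices are admissible. Pascal's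
  rule merges their coefficients into one for \<open>Suc n\<close>, which is at most the central
  one.\<close>

lemma binavg_window_le:
  "binavg n (\<lambda>s. of_bool (\<bar>t + s\<bar> = 1)) \<le> real (Suc n choose (Suc n div 2)) / 2 ^ n"
proof -
  let ?P = "\<lambda>i::nat. \<bar>t + (2 * real i - real n)\<bar> = 1"
  let ?f = "\<lambda>i. real (n choose i) * of_bool (?P i)"
  have window: "i' \<le> Suc i" if "?P i" "?P i'" for i i'
    using that by (auto simp: abs_if split: if_splits)
  have "(\<Sum>i\<le>n. ?f i) \<le> real (Suc n choose (Suc n div 2))"
  proof (cases "\<exists>i. ?P i")
    case False
    then show ?thesis by simp
  next
    case True
    define i where "i = (LEAST i. ?P i)"
    have i: "?P i" "\<And>i'. ?P i' \<Longrightarrow> i \<le> i'"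
      unfolding i_def using True by (auto intro: LeastI Least_le)
    have "i' \<in> {i, Suc i}" if "?P i'" for i'
      using window[OF i(1) that] i(2)[OF that] by auto
    then have "(\<Sum>i'\<le>n. ?f i') \<le> (\<Sum>i'\<le>n. if i' \<in> {i, Suc i} then real (n choose i') else 0)"
      by (intro sum_mono) auto
    also have "\<dots> = (\<Sum>i'\<in>{..n} \<inter> {i, Suc i}. real (n choose i'))"
      by (simp add: sum.inter_restrict)
    also have "\<dots> \<le> (\<Sum>i'\<in>{i, Suc i}. real (n choose i'))"
      by (intro sum_mono2) auto
    also have "\<dots> = real (Suc n choose Suc i)"
      by simp
    also have "\<dots> \<le> real (Suc n choose (Suc n div 2))"
      by (intro of_nat_mono binomial_maximum)
    finally show ?thesis .
  qed
  then show ?thesis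
    unfolding binavg_def by (intro divide_right_mono) auto
qed

text \<open>The signs outside \<open>W\<close> only shift the window, and the window bound is
  uniform in the shift.\<close>

lemma prob_row_units_le:
  assumes "finite I" "W \<subseteq> supp I b" "unit_row I b" "\<And>X Z. Z \<subseteq> W \<Longrightarrow> Q (X \<union> Z) = Q X"
  shows "prob_on I (\<lambda>X. Q X \<and> row_ok I b X)
      \<le> real (Suc (card W) choose (Suc (card W) div 2)) / 2 ^ card W * prob_on I Q"
proof -
  have WI: "W \<subseteq> I" using assms(2) by (auto simp: supp_def)
  have "avg I (\<lambda>X. of_bool (Q X) * of_bool (row_ok I b X))
      \<le> real (Suc (card W) choose (Suc (card W) div 2)) / 2 ^ card W * prob_on I Q"
  proof (rule avg_le_cond[OF assms(1) WI])
    show "Q (Y \<union> Z) = Q Y \<or> \<not> Z \<subseteq> W" for Y Z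
      using assms(4) by blast
  next
    fix Y assume Y: "Y \<subseteq> I - W"
    define t where "t = rsum (I - W) b Y"
    have "prob_on W (\<lambda>Z. row_ok I b (Y \<union> Z)) = prob_on W (\<lambda>Z. \<bar>t + rsum W b Z\<bar> = 1)"
      using rsum_diff[OF assms(1) WI Y]
      by (intro avg_cong) (auto simp: row_ok_def t_def)
    also have "\<dots> = binavg (card W) (\<lambda>s. of_bool (\<bar>t + s\<bar> = 1))"
      using WI assms(1,2) unit_row_abs[OF assms(3)]
      by (intro avg_rsum_units) (auto intro: finite_subset)
    also have "\<dots> \<le> real (Suc (card W) choose (Suc (card W) div 2)) / 2 ^ card W"
      by (rule binavg_window_le)
    finally show "prob_on W (\<lambda>Z. row_ok I b (Y \<union> Z))
        \<le> real (Suc (card W) choose (Suc (card W) div 2)) / 2 ^ card W" .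
  qed
  then show ?thesis by (simp add: of_bool_conj)
qed

lemma prob_unit_row:
  assumes "finite I" "unit_row I b"
  shows "prob_on I (row_ok I b) = binavg (card (supp I b)) (\<lambda>s. of_bool (\<bar>s\<bar> = 1))"
  unfolding row_ok_def using assms by (rule avg_rsum_unit_row)

text \<open>A sum of an even number of signs is even.\<close>

lemma prob_unit_row_even:
  assumes "finite I" "unit_row I b" "even (card (supp I b))"
  shows "prob_on I (row_ok I b) = 0"
proof -
  have "\<bar>2 * real i - real (card (supp I b))\<bar> \<noteq> 1" for i
  proof
    assume "\<bar>2 * real i - real (card (supp I b))\<bar> = 1"
    then have "\<bar>2 * int i - int (card (supp I b))\<bar> = 1" by linarith
    then have "odd (2 * int i - int (card (supp I b)))" by presburger
    then show False using assms(3) by simp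
  qed
  then show ?thesis
    unfolding prob_unit_row[OF assms(1,2)] binavg_def by simp
qed

lemma prob_unit_row_le:
  assumes "finite I" "unit_row I b" "n \<le> card (supp I b)"
  shows "prob_on I (row_ok I b) \<le> real (Suc n choose (Suc n div 2)) / 2 ^ n"
proof -
  obtain W where W: "W \<subseteq> supp I b" "card W = n"
    using obtain_subset_with_card_n[OF assms(3)] by metis
  show ?thesis
    using prob_row_units_le[of I W b "\<lambda>_. True"] assms W avg_const[OF assms(1), of 1] by simp
qed

section \<open>Adding a row to a system\<close>

lemma good_insert: "good I (insert b R) X \<longleftrightarrow> good I R X \<and> row_ok I b X"
  by (auto simp: good_def)

lemma prob_good_antimono: "R' \<subseteq> R \<Longrightarrow> prob_on I (good I R) \<le> prob_on I (good I R')"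
  by (intro prob_on_mono) (auto simp: good_def)

lemma prob_good_insert_outside:
  assumes "finite I" "card (supp I b - \<Union>(supp I ` R)) \<ge> 2"
  shows "prob_on I (good I (insert b R)) \<le> 3/4 * prob_on I (good I R)"
  unfolding good_insert
  by (rule prob_two_outside_le[OF assms]) (rule good_cong[OF assms(1) order_refl])

text \<open>A further row either has two new coordinates, which costs a factor \<open>3/4\<close>, or keeps the number
  of coordinates at most six, which makes the probability a multiple of \<open>1/32\<close>.\<close>
lemma prob_le_half_gap:
  assumes "finite I" "R' \<subseteq> R" "prob_on I (good I R') \<le> 1/2" "card (\<Union>(supp I ` R')) \<le> 5"
  shows "prob_on I (good I R) \<le> 15/32 \<or> prob_on I (good I R) = 1/2"
proof (rule disjCI)
  assume not_half: "prob_on I (good I R) \<noteq> 1/2"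
  let ?M = "\<Union>(supp I ` R')"
  have finM: "finite ?M"
    using assms(1) by (rule finite_subset[rotated]) (auto simp: supp_def)
  \<comment> \<open>For a single extra row: two new coordinates would push the probability down to
    3/8, and with at most six coordinates 16/32 is the only multiple of 1/32 above 15/32 and at most
    1/2.\<close>
  have eq: "prob_on I (good I (insert b R')) = 1/2"
    if "b \<in> R" "prob_on I (good I R) > 15/32" for b
  proof -
    have low: "prob_on I (good I (insert b R')) > 15/32"
      using prob_good_antimono[of "insert b R'" R I] that assms(2) by auto
    have high: "prob_on I (good I (insert b R')) \<le> 1/2"
      using prob_good_antimono[OF subset_insertI[of R' b], of I] assms(3) by linarith
    have "card (supp I b - ?M) < 2"
      using prob_good_insert_outside[OF assms(1), of b R'] low assms(3) by force
    then have "card (\<Union>(supp I ` insert b R')) \<le> Suc 5"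
      using card_Un_disjoint[of ?M "supp I b - ?M"] finM assms(1,4)
      by (simp add: supp_def Un_commute)
    then obtain n :: nat where "prob_on I (good I (insert b R')) = n / 2 ^ 5"
      using prob_good_granular[OF assms(1)] by blast
    with low high have "real n > 15" "real n \<le> 16" by auto
    then have "n = 16" by linarith
    with \<open>prob_on I (good I (insert b R')) = n / 2 ^ 5\<close> show ?thesis by simp
  qed
  show "prob_on I (good I R) \<le> 15/32"
  proof (rule ccontr)
    assume low: "\<not> prob_on I (good I R) \<le> 15/32"
    show False
    proof (cases "R = {}")
      case True
      then have "R' = R" using assms(2) by simp
      then show False using assms(1,3) True avg_const[OF assms(1), of 1] by (simp add: good_def)
    next
      case False
      then obtain b0 where "b0 \<in> R" by blast
      have half: "prob_on I (good I R') = 1/2"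
        using eq[OF \<open>b0 \<in> R\<close>] low assms(3) prob_good_antimono[OF subset_insertI[of R' b0], of I] by force
      \<comment> \<open>Nested events of equal probability coincide, so \<open>R'\<close> already
        implies each row of \<open>R\<close> and the whole system has probability 1/2.\<close>
      have "good I (insert b R') X" if "b \<in> R" "X \<subseteq> I" "good I R' X" for b X
      proof (rule prob_on_eq_imp[where P = "good I (insert b R')" and Q = "good I R'"])
        show "prob_on I (good I (insert b R')) = prob_on I (good I R')"
          using eq[OF that(1)] low half by simp
      qed (use assms(1) that in \<open>auto simp: good_def\<close>)
      then have "prob_on I (good I R') \<le> prob_on I (good I R)"
        by (intro prob_on_mono) (auto simp: good_def)
      then show False
        using half not_half prob_good_antimono[OF assms(2), of I] by simp
    qed
  qed
qed

text \<open>If both signs at \<open>j\<close> satisfied the row, \<open>b j\<close> would be 0, 1 or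
  -1; so at most one of them works. Five further nonzero summands produce at least six sums, of
  which at most the four in \<open>?T\<close> help, and
  \<open>1/2 * (1 - 2/32) = 15/32\<close>.\<close>

lemma prob_nonunit_row_le:
  assumes "finite I" "j \<in> I" "b j \<noteq> 0" "\<bar>b j\<bar> \<noteq> 1"
  shows "prob_on I (row_ok I b) \<le> 1/2"
    and "card (supp I b) \<ge> 6 \<Longrightarrow> prob_on I (row_ok I b) \<le> 15/32"
proof -
  let ?J = "I - {j}" and ?c = "b j"
  let ?T = "\<lambda>t. {1 - ?c - t, 1 + ?c - t, -1 - ?c - t, -1 + ?c - t}"
  define hit where "hit = (\<lambda>X. rsum ?J b X \<in> ?T 0)"
  have eq: "prob_on I (row_ok I b) = 1/2 * prob_on ?J hit"
    unfolding avg_diff1[OF assms(1,2)] avg_cmult[symmetric]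
  proof (intro avg_cong)
    fix X assume "X \<subseteq> ?J"
    then show "(of_bool (row_ok I b X) + of_bool (row_ok I b (insert j X))) / 2
        = 1/2 * (of_bool (hit X) :: real)"
    proof -
      let ?s = "rsum ?J b X"
      have "row_ok I b X \<longleftrightarrow> ?s = 1 + ?c \<or> ?s = -1 + ?c"
        unfolding row_ok_def rsum_off[OF assms(1,2) \<open>X \<subseteq> ?J\<close>] by linarith
      moreover have "row_ok I b (insert j X) \<longleftrightarrow> ?s = 1 - ?c \<or> ?s = -1 - ?c"
        unfolding row_ok_def rsum_on[OF assms(1,2) \<open>X \<subseteq> ?J\<close>] by linarith
      moreover have "\<not> ((?s = 1 + ?c \<or> ?s = -1 + ?c) \<and> (?s = 1 - ?c \<or> ?s = -1 - ?c))"
        using assms(3,4) by linarith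
      ultimately show ?thesis by (auto simp: hit_def)
    qed
  qed
  have "prob_on ?J hit \<le> prob_on ?J (\<lambda>X. True)"
    by (intro prob_on_mono) auto
  also have "\<dots> = 1" using assms(1) by (simp add: avg_const)
  finally show "prob_on I (row_ok I b) \<le> 1/2" using eq by simp
  assume "card (supp I b) \<ge> 6"
  moreover have "card (supp I b - {j}) = card (supp I b) - 1"
    using assms by (intro card_Diff_singleton) (auto simp: supp_def)
  ultimately have "5 \<le> card (supp I b - {j})" by simp
  from obtain_subset_with_card_n[OF this] obtain W
    where W: "W \<subseteq> supp I b - {j}" "card W = 5" "finite W" by metis
  have WJ: "W \<subseteq> ?J" using W by (auto simp: supp_def)
  have "avg ?J (\<lambda>X. of_bool True * of_bool (hit X)) \<le> 15/16 * prob_on ?J (\<lambda>_. True)"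
  proof (rule avg_le_cond[OF _ WJ])
    fix Y assume Y: "Y \<subseteq> ?J - W"
    define t where "t = rsum (?J - W) b Y"
    have "prob_on W (\<lambda>Z. hit (Y \<union> Z)) = prob_on W (\<lambda>Z. rsum W b Z \<in> ?T t)"
      using rsum_diff[OF _ WJ Y] assms(1)
      by (intro avg_cong) (auto simp: hit_def t_def algebra_simps)
    also have "\<dots> \<le> 1 - (real (card W) + 1 - real (card (?T t))) / 2 ^ card W"
      using W by (intro prob_rsum_mem_le) (auto simp: supp_def)
    also have "\<dots> \<le> 15/16"
    proof -
      have "card (?T t) \<le> 4" by (simp add: card_insert_if)
      then show ?thesis using W by simp
    qed
    finally show "prob_on W (\<lambda>Z. hit (Y \<union> Z)) \<le> 15/16" .
  qed (simp_all add: assms(1))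
  then have "prob_on ?J hit \<le> 15/16"
    using assms(1) by (simp add: avg_const)
  then show "prob_on I (row_ok I b) \<le> 15/32" using eq by simp
qed

subsection \<open>Pairs of unit rows\<close>

text \<open>The probability that a uniform sign repairs a partial sum \<open>s\<close>, i.e. that \<open>\<bar>s \<plusminus> 1\<bar> = 1\<close>.\<close>
definition last_sign :: "real \<Rightarrow> real" where
  "last_sign s = (if s = 0 then 1 else if \<bar>s\<bar> = 2 then 1/2 else 0)"

lemma last_sign_cases: "last_sign s = 0 \<or> last_sign s = 1/2 \<or> last_sign s = 1"
  by (simp add: last_sign_def)

lemma last_sign_avg: "(of_bool (\<bar>s - 1\<bar> = 1) + of_bool (\<bar>s + 1\<bar> = 1)) / 2 = last_sign s"
  by (auto simp: last_sign_def abs_if split: if_splits)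

lemma rsum_remove: "finite I \<Longrightarrow> b i = 0 \<Longrightarrow> rsum I b X = rsum (I - {i}) b X"
  unfolding rsum_def by (intro sum.mono_neutral_right) auto

lemma rsum_insert_zero: "b i = 0 \<Longrightarrow> rsum I b (insert i X) = rsum I b X"
  unfolding rsum_def by (intro sum.cong) (auto simp: sg_def)

text \<open>Integrates out the sign at \<open>i\<close>, which \<open>f\<close> does not
  see.\<close>

lemma avg_last_sign:
  assumes "finite I" "i \<in> I" "\<bar>b i\<bar> = 1" "\<And>X. f (insert i X) = f X"
  shows "avg I (\<lambda>X. f X * of_bool (row_ok I b X)) = avg (I - {i}) (\<lambda>X. f X * last_sign (rsum (I - {i}) b X))"
  unfolding avg_diff1[OF assms(1,2)]
proof (intro avg_cong)
  fix X assume X: "X \<subseteq> I - {i}"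
  let ?s = "rsum (I - {i}) b X"
  have "b i = 1 \<or> b i = -1" using assms(3) by linarith
  then have "(of_bool (\<bar>?s - b i\<bar> = 1) + of_bool (\<bar>?s + b i\<bar> = 1)) / 2 = last_sign ?s"
    using last_sign_avg[of ?s]
    by (elim disjE) (simp_all only: diff_minus_eq_add add_uminus_conv_diff
        add.commute[of "of_bool (\<bar>?s + 1\<bar> = 1)"])
  then show "(f X * of_bool (row_ok I b X) + f (insert i X) * of_bool (row_ok I b (insert i X))) / 2
      = f X * last_sign ?s"
    unfolding row_ok_def rsum_off[OF assms(1,2) X] rsum_on[OF assms(1,2) X] assms(4)
    by (metis (no_types, lifting) distrib_left times_divide_eq_right)
qed

text \<open>Of the two rows only \<open>b\<close> sees \<open>i\<close> and only \<open>c\<close>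
  sees \<open>j\<close>, so the rows are independent given all other signs.\<close>

lemma avg_two_last_signs:
  assumes "finite I" "i \<in> I" "j \<in> I" "\<bar>b i\<bar> = 1" "\<bar>c j\<bar> = 1" "b j = 0" "c i = 0" "i \<noteq> j"
    and "\<And>X. f (insert i X) = f X" "\<And>X. f (insert j X) = f X"
  shows "avg I (\<lambda>X. f X * of_bool (row_ok I b X) * of_bool (row_ok I c X))
    = avg (I - {i, j}) (\<lambda>X. f X * last_sign (rsum (I - {i, j}) b X) * last_sign (rsum (I - {i, j}) c X))"
proof -
  have J: "I - {j} - {i} = I - {i, j}" by blast
  have "avg I (\<lambda>X. (f X * of_bool (row_ok I b X)) * of_bool (row_ok I c X))
      = avg (I - {j}) (\<lambda>X. (f X * of_bool (row_ok I b X)) * last_sign (rsum (I - {j}) c X))"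
    using assms by (intro avg_last_sign) (simp_all add: row_ok_def rsum_insert_zero)
  also have "\<dots> = avg (I - {j}) (\<lambda>X. (f X * last_sign (rsum (I - {j}) c X)) * of_bool (row_ok (I - {j}) b X))"
    by (intro avg_cong) (simp add: row_ok_def rsum_remove[of I b j] assms)
  also have "\<dots> = avg (I - {i, j}) (\<lambda>X. (f X * last_sign (rsum (I - {j}) c X)) * last_sign (rsum (I - {i, j}) b X))"
    unfolding J[symmetric]
    using assms by (intro avg_last_sign) (simp_all add: row_ok_def rsum_insert_zero)
  also have "\<dots> = avg (I - {i, j}) (\<lambda>X. f X * last_sign (rsum (I - {i, j}) b X) * last_sign (rsum (I - {i, j}) c X))"
    using assms rsum_remove[of "I - {j}" c i] unfolding J[symmetric]
    by (intro avg_cong) (simp add: mult_ac)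
  finally show ?thesis .
qed

text \<open>Moments for the AM-GM estimates: squares for rows of size 3, 7 and 9 with one coordinate
  removed, the cube for rows of size 5.\<close>

lemma binavg_last_sign:
  "binavg 2 (\<lambda>s. last_sign s ^ 2) = 5/8"
  "binavg 6 (\<lambda>s. last_sign s ^ 2) = 55/128"
  "binavg 8 (\<lambda>s. last_sign s ^ 2) = 49/128"
  "binavg 4 (\<lambda>s. last_sign s ^ 3) = 7/16"
  by (simp_all add: binavg_def last_sign_def atMost_nat_numeral binomial_fact fact_numeral power_divide)

lemma binavg_odd:
  "binavg 3 (\<lambda>s. of_bool (\<bar>s\<bar> = 1)) = 3/4"
  "binavg 5 (\<lambda>s. of_bool (\<bar>s\<bar> = 1)) = 5/8"
  "binavg 7 (\<lambda>s. of_bool (\<bar>s\<bar> = 1)) = 35/64"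
  "binavg 9 (\<lambda>s. of_bool (\<bar>s\<bar> = 1)) = 63/128"
  by (simp_all add: binavg_def atMost_nat_numeral atMost_Suc Int_insert_left binomial_fact fact_numeral)

lemma unit_row_diff: "unit_row I b \<Longrightarrow> unit_row (I - A) b"
  by (auto simp: unit_row_def)

lemma supp_diff: "supp (I - A) b = supp I b - A"
  by (auto simp: supp_def)

lemma card_supp_remove:
  assumes "finite I" "i \<in> supp I b" "j \<notin> supp I b"
  shows "card (supp (I - {i, j}) b) = card (supp I b) - 1"
proof -
  have "supp (I - {i, j}) b = supp I b - {i}" using assms by (auto simp: supp_def)
  then show ?thesis using assms by simp
qed

text \<open>With \<open>i\<close> and \<open>j\<close> integrated out, the joint probability is the
  mean of a product of two \<open>last_sign\<close> factors. AM-GM passes to their squares, which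
  have equal expectation because \<open>n\<close> signs remain in each row.\<close>

lemma prob_exchange_le:
  assumes "finite I" "unit_row I b" "unit_row I c" "card (supp I b) = Suc n" "card (supp I c) = Suc n"
    and "i \<in> supp I b - supp I c" "j \<in> supp I c - supp I b"
  shows "prob_on I (\<lambda>X. row_ok I b X \<and> row_ok I c X) \<le> binavg n (\<lambda>s. last_sign s ^ 2)"
proof -
  let ?J = "I - {i, j}"
  have ij: "i \<in> I" "j \<in> I" "\<bar>b i\<bar> = 1" "\<bar>c j\<bar> = 1" "b j = 0" "c i = 0" "i \<noteq> j"
    using assms(6,7) unit_row_abs[OF assms(2)] unit_row_abs[OF assms(3)] by (auto simp: supp_def)
  have n: "card (supp ?J b) = n" "card (supp ?J c) = n"
    using card_supp_remove[of I i b j] card_supp_remove[of I j c i] assms(1,4-7)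
    by (auto simp: insert_commute)
  have "prob_on I (\<lambda>X. row_ok I b X \<and> row_ok I c X)
      = avg I (\<lambda>X. 1 * of_bool (row_ok I b X) * of_bool (row_ok I c X))"
    by (simp add: of_bool_conj)
  also have "\<dots> = avg ?J (\<lambda>X. 1 * last_sign (rsum ?J b X) * last_sign (rsum ?J c X))"
    by (rule avg_two_last_signs) (use assms(1) ij in simp_all)
  also have "\<dots> \<le> avg ?J (\<lambda>X. 1/2 * last_sign (rsum ?J b X) ^ 2 + 1/2 * last_sign (rsum ?J c X) ^ 2)"
  proof (intro avg_mono)
    have amgm: "1 * u * v \<le> 1/2 * u\<^sup>2 + 1/2 * v\<^sup>2" for u v :: real
      using sum_squares_bound[of u v] by simp
    show "1 * last_sign (rsum ?J b X) * last_sign (rsum ?J c X)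
        \<le> 1/2 * last_sign (rsum ?J b X) ^ 2 + 1/2 * last_sign (rsum ?J c X) ^ 2" for X
      by (rule amgm)
  qed
  also have "\<dots> = 1/2 * binavg n (\<lambda>s. last_sign s ^ 2) + 1/2 * binavg n (\<lambda>s. last_sign s ^ 2)"
    unfolding avg_add avg_cmult n(1)[symmetric]
      avg_rsum_unit_row[OF finite_Diff[OF assms(1)] unit_row_diff[OF assms(2)], symmetric]
    using avg_rsum_unit_row[OF finite_Diff[OF assms(1)] unit_row_diff[OF assms(3)],
        of "{i, j}" "\<lambda>s. last_sign s ^ 2"]
      avg_rsum_unit_row[OF finite_Diff[OF assms(1)] unit_row_diff[OF assms(2)],
        of "{i, j}" "\<lambda>s. last_sign s ^ 2"] n
    by simp
  finally show ?thesis by simp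
qed

text \<open>Here \<open>s\<close> and \<open>t\<close> are the sums of two rows without a common
  pair, at which the coefficients are \<open>u\<close>, \<open>v\<close> in one row and
  \<open>u\<close>, \<open>- v\<close> in the other. For each pattern of the pair one row receives 0
  and the other 2 or -2. The former must already be at 1 or -1, and the latter cannot succeed with
  both 2 and -2.\<close>

lemma four_signs_le:
  fixes s t u v :: real
  assumes "u = 1 \<or> u = -1" "v = 1 \<or> v = -1"
  shows "((of_bool (\<bar>s - u - v\<bar> = 1 \<and> \<bar>t - u + v\<bar> = 1) + of_bool (\<bar>s - u + v\<bar> = 1 \<and> \<bar>t - u - v\<bar> = 1)) / 2
    + (of_bool (\<bar>s + u - v\<bar> = 1 \<and> \<bar>t + u + v\<bar> = 1) + of_bool (\<bar>s + u + v\<bar> = 1 \<and> \<bar>t + u - v\<bar> = 1)) / 2) / 2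
    \<le> 1/4 * of_bool (\<bar>s\<bar> = 1) + (1/4 * of_bool (\<bar>t\<bar> = 1) :: real)"
proof -
  have iff: "\<bar>x - u - v\<bar> = 1 \<longleftrightarrow> x = u + v + 1 \<or> x = u + v - 1"
    "\<bar>x - u + v\<bar> = 1 \<longleftrightarrow> x = u - v + 1 \<or> x = u - v - 1"
    "\<bar>x + u - v\<bar> = 1 \<longleftrightarrow> x = v - u + 1 \<or> x = v - u - 1"
    "\<bar>x + u + v\<bar> = 1 \<longleftrightarrow> x = 1 - u - v \<or> x = - 1 - u - v"
    "\<bar>x\<bar> = 1 \<longleftrightarrow> x = 1 \<or> x = -1" for x
    by linarith+
  \<comment> \<open>Every condition forces one of the values 1, -1, 3, -3, so five cases for each
    sum suffice.\<close>
  have "x = 1 \<or> x = -1 \<or> x = 3 \<or> x = -3 \<or> (x \<noteq> 1 \<and> x \<noteq> -1 \<and> x \<noteq> 3 \<and> x \<noteq> -3)" for x :: real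
    by blast
  from this[of s] this[of t] show ?thesis
    unfolding iff using assms by (elim disjE) simp_all
qed

text \<open>Conditioning on all signs except those at \<open>i\<close> and \<open>j\<close> reduces
  this to the preceding pointwise bound; equal support sizes make its two terms equal in
  mean.\<close>

lemma prob_sign_conflict_le:
  assumes "finite I" "unit_row I b" "unit_row I c"
    and "i \<in> supp I b" "j \<in> supp I b" "i \<noteq> j" "c i = b i" "c j = - b j" "card (supp I c) = card (supp I b)"
  shows "prob_on I (\<lambda>X. row_ok I b X \<and> row_ok I c X)
    \<le> 1/2 * binavg (card (supp I b) - 2) (\<lambda>s. of_bool (\<bar>s\<bar> = 1))"
proof -
  let ?J = "I - {j} - {i}" and ?B = "binavg (card (supp I b) - 2) (\<lambda>s. of_bool (\<bar>s\<bar> = 1))"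
  have I: "i \<in> I" "j \<in> I" "i \<in> I - {j}" "finite (I - {j})"
    using assms by (auto simp: supp_def)
  have unit: "b i = 1 \<or> b i = -1" "b j = 1 \<or> b j = -1"
    using unit_row_abs[OF assms(2,4)] unit_row_abs[OF assms(2,5)] by linarith+
  have card2: "card (supp ?J r) = card (supp I r) - 2" if "i \<in> supp I r" "j \<in> supp I r" for r
  proof -
    have "finite (supp I r)" using assms(1) by (simp add: supp_def)
    then show ?thesis using that assms(6) unfolding supp_diff by simp
  qed
  have avgJ: "prob_on ?J (\<lambda>X. \<bar>rsum ?J r X\<bar> = 1) = binavg (card (supp ?J r)) (\<lambda>s. of_bool (\<bar>s\<bar> = 1))"
    if "unit_row I r" for r
    using assms(1) that by (intro avg_rsum_unit_row) (auto simp: unit_row_def)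
  have inc: "i \<in> supp I c" "j \<in> supp I c" using assms(4,5,7,8) by (auto simp: supp_def)
  have "prob_on I (\<lambda>X. row_ok I b X \<and> row_ok I c X)
      \<le> avg ?J (\<lambda>X. 1/4 * of_bool (\<bar>rsum ?J b X\<bar> = 1) + 1/4 * of_bool (\<bar>rsum ?J c X\<bar> = 1))"
    unfolding avg_diff1[OF assms(1) I(2)] avg_diff1[OF I(4,3)]
  proof (intro avg_mono)
    fix X assume X: "X \<subseteq> ?J"
    then have X': "X \<subseteq> I - {j}" "insert i X \<subseteq> I - {j}" using I(3) by auto
    note sums = rsum_off[OF assms(1) I(2)] rsum_on[OF assms(1) I(2)] rsum_off[OF I(4,3) X] rsum_on[OF I(4,3) X]
    define s t where "s = rsum ?J b X" and "t = rsum ?J c X"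
    have rows: "row_ok I b X \<longleftrightarrow> \<bar>s - b i - b j\<bar> = 1" "row_ok I c X \<longleftrightarrow> \<bar>t - b i + b j\<bar> = 1"
      "row_ok I b (insert i X) \<longleftrightarrow> \<bar>s + b i - b j\<bar> = 1" "row_ok I c (insert i X) \<longleftrightarrow> \<bar>t + b i + b j\<bar> = 1"
      "row_ok I b (insert j X) \<longleftrightarrow> \<bar>s - b i + b j\<bar> = 1" "row_ok I c (insert j X) \<longleftrightarrow> \<bar>t - b i - b j\<bar> = 1"
      "row_ok I b (insert j (insert i X)) \<longleftrightarrow> \<bar>s + b i + b j\<bar> = 1"
      "row_ok I c (insert j (insert i X)) \<longleftrightarrow> \<bar>t + b i - b j\<bar> = 1"
      unfolding row_ok_def sums(1,2)[OF X'(1)] sums(1,2)[OF X'(2)] sums(3,4) assms(7,8) s_def t_def by simp_all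
    show "((of_bool (row_ok I b X \<and> row_ok I c X) + of_bool (row_ok I b (insert j X) \<and> row_ok I c (insert j X))) / 2
        + (of_bool (row_ok I b (insert i X) \<and> row_ok I c (insert i X))
          + of_bool (row_ok I b (insert j (insert i X)) \<and> row_ok I c (insert j (insert i X)))) / 2) / 2
      \<le> 1/4 * of_bool (\<bar>rsum ?J b X\<bar> = 1) + (1/4 * of_bool (\<bar>rsum ?J c X\<bar> = 1) :: real)"
      unfolding rows s_def[symmetric] t_def[symmetric] using unit by (rule four_signs_le)
  qed
  also have "\<dots> = 1/4 * ?B + 1/4 * ?B"
    unfolding avg_add avg_cmult avgJ[OF assms(2)] avgJ[OF assms(3)] card2[OF assms(4,5)] card2[OF inc] assms(9) ..
  finally show ?thesis by simp
qed

section \<open>Cancelling pairs of signs\<close>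

definition opposed :: "('a \<Rightarrow> real) \<Rightarrow> 'a \<Rightarrow> 'a \<Rightarrow> 'a set \<Rightarrow> bool" where
  "opposed c x y X \<longleftrightarrow> c x * sg X x + c y * sg X y = 0"

lemma opposed_Un: "x \<notin> Z \<Longrightarrow> y \<notin> Z \<Longrightarrow> opposed c x y (X \<union> Z) = opposed c x y X"
  by (simp add: opposed_def sg_def)

text \<open>Whatever the sign at \<open>y\<close>, exactly one sign at \<open>x\<close> cancels
  it.\<close>

lemma prob_opposed:
  assumes "finite I" "x \<in> I" "x \<noteq> y" "\<bar>c x\<bar> = 1" "\<bar>c y\<bar> = 1"
  shows "prob_on I (opposed c x y) = 1/2"
proof -
  have c: "c x = 1 \<or> c x = -1" "c y = 1 \<or> c y = -1" using assms(4,5) by linarith+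
  have "prob_on I (opposed c x y) = avg (I - {x}) (\<lambda>X. 1/2)"
    unfolding avg_diff1[OF assms(1,2)]
  proof (intro avg_cong)
    fix X assume "X \<subseteq> I - {x}"
    then have "x \<notin> X" by blast
    then show "(of_bool (opposed c x y X) + of_bool (opposed c x y (insert x X))) / 2 = (1/2 :: real)"
      using c assms(3) by (cases "y \<in> X") (auto simp: opposed_def sg_def)
  qed
  then show ?thesis using assms(1) by (simp add: avg_const)
qed

text \<open>The pair uses up at most two coordinates of the support, so \<open>n\<close> signs of
  the row stay free of the conditioning event.\<close>

lemma prob_opposed_row_le:
  assumes "finite I" "x \<in> I" "x \<noteq> y" "\<bar>c x\<bar> = 1" "\<bar>c y\<bar> = 1"
    and "unit_row I b" "n + 2 \<le> card (supp I b)"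
  shows "prob_on I (\<lambda>X. opposed c x y X \<and> row_ok I b X) \<le> real (Suc n choose (Suc n div 2)) / 2 ^ n * (1/2)"
proof -
  have "card (supp I b) - card {x, y} \<le> card (supp I b - {x, y})"
    by (rule diff_card_le_card_Diff) simp
  moreover have "card {x, y} = 2" using assms(3) by simp
  ultimately have "n \<le> card (supp I b - {x, y})" using assms(7) by linarith
  from obtain_subset_with_card_n[OF this] obtain W
    where W: "W \<subseteq> supp I b - {x, y}" "card W = n" by metis
  have "prob_on I (\<lambda>X. opposed c x y X \<and> row_ok I b X)
      \<le> real (Suc (card W) choose (Suc (card W) div 2)) / 2 ^ card W * prob_on I (opposed c x y)"
    using W assms(6) by (intro prob_row_units_le[OF assms(1)] opposed_Un) auto
  then show ?thesis
    unfolding prob_opposed[OF assms(1-5)] W(2) .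
qed

lemma rsum_three:
  assumes "finite I" "supp I c = {x, y, z}" "x \<noteq> y" "y \<noteq> z" "x \<noteq> z"
  shows "rsum I c X = c x * sg X x + c y * sg X y + c z * sg X z"
proof -
  have "supp I c \<subseteq> I" by (auto simp: supp_def)
  then have "rsum I c X = rsum (supp I c) c X"
    using assms(1) unfolding rsum_def by (intro sum.mono_neutral_right) (auto simp: supp_def)
  then show ?thesis using assms(2-5) by (simp add: rsum_def)
qed

text \<open>Three terms 1 or -1 have a sum of absolute value 1 exactly when they are not all equal;
  then exactly two of the three pairs cancel, whence the factor 1/2.\<close>

lemma row_ok_three:
  assumes "finite I" "unit_row I c" "supp I c = {x, y, z}" "x \<noteq> y" "y \<noteq> z" "x \<noteq> z"
  shows "row_ok I c X \<longleftrightarrow> opposed c x y X \<or> opposed c y z X"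
    and "of_bool (row_ok I c X)
      = 1/2 * of_bool (opposed c x y X) + 1/2 * of_bool (opposed c y z X) + 1/2 * (of_bool (opposed c x z X) :: real)"
proof -
  have "\<bar>c x\<bar> = 1" "\<bar>c y\<bar> = 1" "\<bar>c z\<bar> = 1"
    using unit_row_abs[OF assms(2)] assms(3) by auto
  then have "c x = 1 \<or> c x = -1" "c y = 1 \<or> c y = -1" "c z = 1 \<or> c z = -1" by linarith+
  moreover have "sg X j = 1 \<or> sg X j = -1" for j by (simp add: sg_def)
  ultimately have signs: "c x * sg X x = 1 \<or> c x * sg X x = -1" "c y * sg X y = 1 \<or> c y * sg X y = -1"
    "c z * sg X z = 1 \<or> c z * sg X z = -1"
    by (metis mult.right_neutral mult_minus_left mult_minus_right minus_minus)+
  then show "row_ok I c X \<longleftrightarrow> opposed c x y X \<or> opposed c y z X"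
    unfolding row_ok_def opposed_def rsum_three[OF assms(1,3-6)] by (elim disjE) simp_all
  show "of_bool (row_ok I c X)
      = 1/2 * of_bool (opposed c x y X) + 1/2 * of_bool (opposed c y z X) + 1/2 * (of_bool (opposed c x z X) :: real)"
    using signs
    unfolding row_ok_def opposed_def rsum_three[OF assms(1,3-6)] by (elim disjE) simp_all
qed

text \<open>Each cancelling pair leaves five free signs of the long row, hence probability at most
  \<open>20/32 * 1/2 = 5/16\<close>; three such terms of weight 1/2 give exactly 15/32.\<close>

lemma prob_three_seven_le:
  assumes "finite I" "unit_row I b" "unit_row I c" "card (supp I b) \<ge> 7" "card (supp I c) = 3"
  shows "prob_on I (\<lambda>X. row_ok I b X \<and> row_ok I c X) \<le> 15/32"
proof -
  obtain x y z where s: "supp I c = {x, y, z}" "x \<noteq> y" "y \<noteq> z" "x \<noteq> z"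
    using assms(5) unfolding card_3_iff by auto
  have c: "\<bar>c x\<bar> = 1" "\<bar>c y\<bar> = 1" "\<bar>c z\<bar> = 1" "x \<in> I" "y \<in> I" "z \<in> I"
    using unit_row_abs[OF assms(3)] s(1) by (auto simp: supp_def)
  have p5: "real (Suc 5 choose (Suc 5 div 2)) / 2 ^ 5 * (1/2) = 5/16"
    by (simp add: binomial_fact fact_numeral)
  have le: "prob_on I (\<lambda>X. opposed c u v X \<and> row_ok I b X) \<le> 5/16"
    if "u \<in> I" "u \<noteq> v" "\<bar>c u\<bar> = 1" "\<bar>c v\<bar> = 1" for u v
    using prob_opposed_row_le[OF assms(1) that assms(2), of 5] assms(4) unfolding p5 by simp
  have "prob_on I (\<lambda>X. row_ok I b X \<and> row_ok I c X)
      = avg I (\<lambda>X. 1/2 * of_bool (opposed c x y X \<and> row_ok I b X)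
        + 1/2 * of_bool (opposed c y z X \<and> row_ok I b X) + 1/2 * of_bool (opposed c x z X \<and> row_ok I b X))"
    using row_ok_three(2)[OF assms(1,3) s] by (intro avg_cong) (simp add: of_bool_conj algebra_simps)
  also have "\<dots> \<le> 1/2 * (5/16) + 1/2 * (5/16) + 1/2 * (5/16)"
    unfolding avg_add avg_cmult using c s by (intro add_mono mult_left_mono le) auto
  finally show ?thesis by simp
qed

text \<open>Meant for a row \<open>c\<close> of size 3 or 5 that has lost its coordinate outside the
  support of \<open>b\<close>. With two coordinates left the square is 1 on cancellation and 1/4
  otherwise. With four left, the remaining coordinate of \<open>b\<close> is integrated out and
  third moments are compared.\<close>

lemma avg_five_last_sign_le:
  assumes "finite I" "unit_row I b" "unit_row I c" "card (supp I b) = 5" "supp I c \<subseteq> supp I b"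
    and "card (supp I c) = 2 \<or> card (supp I c) = 4"
  shows "avg I (\<lambda>X. of_bool (row_ok I b X) * last_sign (rsum I c X) ^ 2) \<le> 7/16"
  using assms(6)
proof
  assume "card (supp I c) = 2"
  then obtain x y where s: "supp I c = {x, y}" "x \<noteq> y" by (auto simp: card_2_iff)
  have c: "\<bar>c x\<bar> = 1" "\<bar>c y\<bar> = 1" "x \<in> I" "y \<in> I"
    using unit_row_abs[OF assms(3)] s(1) by (auto simp: supp_def)
  have sq: "last_sign (rsum I c X) ^ 2 = 1/4 + 3/4 * of_bool (opposed c x y X)" for X
  proof -
    have "rsum I c X = (\<Sum>j\<in>supp I c. c j * sg X j)"
      using assms(1) unfolding rsum_def by (intro sum.mono_neutral_right) (auto simp: supp_def)
    then have "rsum I c X = c x * sg X x + c y * sg X y" using s by simp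
    moreover have "c x = 1 \<or> c x = -1" "c y = 1 \<or> c y = -1" using c by linarith+
    moreover have "sg X x = 1 \<or> sg X x = -1" "sg X y = 1 \<or> sg X y = -1" by (simp_all add: sg_def)
    ultimately show ?thesis
      by (elim disjE) (simp_all add: opposed_def last_sign_def power2_eq_square)
  qed
  have "avg I (\<lambda>X. of_bool (row_ok I b X) * last_sign (rsum I c X) ^ 2)
      = avg I (\<lambda>X. 1/4 * of_bool (row_ok I b X) + 3/4 * of_bool (opposed c x y X \<and> row_ok I b X))"
    unfolding sq by (intro avg_cong) (simp add: of_bool_conj algebra_simps)
  also have "\<dots> = 1/4 * (5/8) + 3/4 * prob_on I (\<lambda>X. opposed c x y X \<and> row_ok I b X)"
    unfolding avg_add avg_cmult prob_unit_row[OF assms(1,2)] assms(4) binavg_odd ..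
  \<comment> \<open>Three signs of the row avoid the pair: \<open>6/8 * 1/2 = 3/8\<close>.\<close>
  also have "\<dots> \<le> 1/4 * (5/8) + 3/4 * (3/8)"
    using prob_opposed_row_le[OF assms(1) c(3) s(2) c(1,2) assms(2), of 3] assms(4)
    by (simp add: binomial_fact fact_numeral)
  finally show ?thesis by simp
next
  assume four: "card (supp I c) = 4"
  have "finite (supp I b)" using assms(1) by (simp add: supp_def)
  then have "card (supp I b - supp I c) = 1"
    using four assms(4,5) by (simp add: card_Diff_subset finite_subset)
  then obtain l where l: "supp I b - supp I c = {l}" by (auto simp: card_1_singleton_iff)
  let ?J = "I - {l}"
  have lI: "l \<in> I" "c l = 0" "\<bar>b l\<bar> = 1"
    using l unit_row_abs[OF assms(2)] by (auto simp: supp_def)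
  have n: "card (supp ?J b) = 4" "card (supp ?J c) = 4"
  proof -
    have "l \<in> supp I b" "supp I c - {l} = supp I c" using l lI by auto
    then show "card (supp ?J b) = 4" "card (supp ?J c) = 4"
      using four assms(4) unfolding supp_diff by simp_all
  qed
  have cube: "avg ?J (\<lambda>X. last_sign (rsum ?J r X) ^ 3) = 7/16"
    if "unit_row I r" "card (supp ?J r) = 4" for r
    using avg_rsum_unit_row[OF finite_Diff[OF assms(1)] unit_row_diff[OF that(1)],
        of "{l}" "\<lambda>s. last_sign s ^ 3"] that(2) binavg_last_sign(4) by simp
  have "avg I (\<lambda>X. of_bool (row_ok I b X) * last_sign (rsum I c X) ^ 2)
      = avg I (\<lambda>X. last_sign (rsum I c X) ^ 2 * of_bool (row_ok I b X))"
    by (simp add: mult.commute)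
  also have "\<dots> = avg ?J (\<lambda>X. last_sign (rsum I c X) ^ 2 * last_sign (rsum ?J b X))"
    using lI assms(1) by (intro avg_last_sign) (simp_all add: rsum_insert_zero)
  also have "\<dots> \<le> avg ?J (\<lambda>X. 2/3 * last_sign (rsum ?J c X) ^ 3 + 1/3 * last_sign (rsum ?J b X) ^ 3)"
    unfolding rsum_remove[of I c l, OF assms(1) lI(2)]
  proof (intro avg_mono)
    fix X
    \<comment> \<open>Weighted AM-GM, checked on the three possible values of
      \<open>last_sign\<close>.\<close>
    have "u ^ 2 * v \<le> 2/3 * u ^ 3 + 1/3 * v ^ 3" if "u = 0 \<or> u = 1/2 \<or> u = 1" "v = 0 \<or> v = 1/2 \<or> v = 1"
      for u v :: real
      using that by (elim disjE; hypsubst; simp add: power_divide)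
    then show "last_sign (rsum ?J c X) ^ 2 * last_sign (rsum ?J b X)
        \<le> 2/3 * last_sign (rsum ?J c X) ^ 3 + 1/3 * last_sign (rsum ?J b X) ^ 3"
      by (simp only: last_sign_cases)
  qed
  also have "\<dots> = 7/16"
    unfolding avg_add avg_cmult cube[OF assms(2) n(1)] cube[OF assms(3) n(2)] by simp
  finally show ?thesis .
qed

text \<open>Integrating out the private coordinates \<open>i\<close> and \<open>j\<close> leaves two
  \<open>last_sign\<close> factors; AM-GM separates them into the means bounded just before.\<close>

lemma prob_five_two_outside_le:
  assumes "finite I" "unit_row I b" "unit_row I c" "unit_row I d" "card (supp I b) = 5"
    and "supp I c - supp I b = {i}" "supp I d - supp I b = {j}" "i \<noteq> j"
    and "card (supp I c) = 3 \<or> card (supp I c) = 5" "card (supp I d) = 3 \<or> card (supp I d) = 5"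
    and "i \<notin> supp I d" "j \<notin> supp I c"
  shows "prob_on I (\<lambda>X. row_ok I b X \<and> row_ok I c X \<and> row_ok I d X) \<le> 7/16"
proof -
  let ?J = "I - {i, j}"
  have ij: "i \<in> I" "j \<in> I" "\<bar>c i\<bar> = 1" "\<bar>d j\<bar> = 1" "c j = 0" "d i = 0" "b i = 0" "b j = 0"
    using assms(6,7,11,12) unit_row_abs[OF assms(3)] unit_row_abs[OF assms(4)] by (auto simp: supp_def)
  have sJ: "supp ?J b = supp I b" "supp ?J c = supp I c - {i}" "supp ?J d = supp I d - {j}"
    using ij by (auto simp: supp_def)
  have b: "rsum I b X = rsum ?J b X" for X
  proof -
    have "rsum I b X = rsum (I - {i}) b X" using assms(1) ij by (intro rsum_remove)
    also have "\<dots> = rsum (I - {i} - {j}) b X" using assms(1) ij by (intro rsum_remove) auto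
    also have "I - {i} - {j} = ?J" by blast
    finally show ?thesis .
  qed
  have cd: "card (supp ?J c) = 2 \<or> card (supp ?J c) = 4" "card (supp ?J d) = 2 \<or> card (supp ?J d) = 4"
    "supp ?J c \<subseteq> supp ?J b" "supp ?J d \<subseteq> supp ?J b"
  proof -
    have "i \<in> supp I c" "j \<in> supp I d" using assms(6,7) by blast+
    then show "card (supp ?J c) = 2 \<or> card (supp ?J c) = 4" "card (supp ?J d) = 2 \<or> card (supp ?J d) = 4"
      unfolding sJ using assms(9,10) by (elim disjE; simp)+
    show "supp ?J c \<subseteq> supp ?J b" "supp ?J d \<subseteq> supp ?J b"
      unfolding sJ using assms(6,7) by blast+
  qed
  have b5: "card (supp ?J b) = 5" using assms(5) sJ(1) by simp
  note le = avg_five_last_sign_le[OF finite_Diff[OF assms(1)] unit_row_diff[OF assms(2)] unit_row_diff b5]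
  have "prob_on I (\<lambda>X. row_ok I b X \<and> row_ok I c X \<and> row_ok I d X)
      = avg I (\<lambda>X. of_bool (row_ok I b X) * of_bool (row_ok I c X) * of_bool (row_ok I d X))"
    by (simp add: of_bool_conj mult.assoc)
  also have "\<dots> = avg ?J (\<lambda>X. of_bool (row_ok I b X) * last_sign (rsum ?J c X) * last_sign (rsum ?J d X))"
    using assms(1,8) ij by (intro avg_two_last_signs) (simp_all add: row_ok_def rsum_insert_zero)
  also have "\<dots> \<le> avg ?J (\<lambda>X. 1/2 * (of_bool (row_ok ?J b X) * last_sign (rsum ?J c X) ^ 2)
      + 1/2 * (of_bool (row_ok ?J b X) * last_sign (rsum ?J d X) ^ 2))"
  proof (intro avg_mono)
    fix X
    show "of_bool (row_ok I b X) * last_sign (rsum ?J c X) * last_sign (rsum ?J d X)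
      \<le> 1/2 * (of_bool (row_ok ?J b X) * last_sign (rsum ?J c X) ^ 2)
        + 1/2 * (of_bool (row_ok ?J b X) * last_sign (rsum ?J d X) ^ 2)"
      using sum_squares_bound[of "last_sign (rsum ?J c X)" "last_sign (rsum ?J d X)"]
      by (simp add: row_ok_def b)
  qed
  also have "\<dots> \<le> 1/2 * (7/16) + 1/2 * (7/16)"
    unfolding avg_add avg_cmult
    by (intro add_mono mult_left_mono le[OF assms(3) cd(3,1)] le[OF assms(4) cd(4,2)]) simp_all
  finally show ?thesis by simp
qed

subsection \<open>Rows supported on three coordinates\<close>

lemma rsum_two:
  assumes "finite I" "supp I c = {x, y}" "x \<noteq> y"
  shows "rsum I c X = c x * sg X x + c y * sg X y"
proof -
  have "rsum I c X = (\<Sum>j\<in>supp I c. c j * sg X j)"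
    using assms(1) unfolding rsum_def by (intro sum.mono_neutral_right) (auto simp: supp_def)
  then show ?thesis using assms by simp
qed

text \<open>The value is 1 on cancellation and 1/2 otherwise, hence affine in the product of the two
  signs: the form that can be expanded and averaged termwise.\<close>

lemma last_sign_two:
  assumes "\<bar>u\<bar> = 1" "\<bar>v\<bar> = 1"
  shows "last_sign (u * sg X x + v * sg X y) = 3/4 - 1/4 * (u * v) * (sg X x * sg X y)"
proof -
  have "u = 1 \<or> u = -1" "v = 1 \<or> v = -1" using assms by linarith+
  moreover have "sg X x = 1 \<or> sg X x = -1" "sg X y = 1 \<or> sg X y = -1" by (simp_all add: sg_def)
  ultimately show ?thesis by (elim disjE) (simp_all add: last_sign_def)
qed

text \<open>With the private coordinates \<open>p\<close>, \<open>q\<close>, \<open>i\<close>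
  integrated out, three affine factors in the signs at \<open>r\<close>, \<open>x\<close>,
  \<open>y\<close> remain. In their product only the constant 27/64 and the full product, where
  every sign is squared, have nonzero mean; the latter contributes 1/64 up to sign.\<close>

lemma prob_triangle_le:
  assumes "finite I" "unit_row I b" "unit_row I c" "unit_row I d"
    and "supp I b = {r, x, p}" "supp I c = {r, y, q}" "supp I d = {x, y, i}" "distinct [r, x, y, p, q, i]"
  shows "prob_on I (\<lambda>X. row_ok I b X \<and> row_ok I c X \<and> row_ok I d X) \<le> 7/16"
proof -
  let ?J = "I - {p, q}" and ?K = "I - {p, q} - {i}"
  have fin: "finite ?J" "finite ?K" using assms(1) by auto
  have I: "r \<in> I" "x \<in> I" "y \<in> I" "p \<in> I" "q \<in> I" "i \<in> I"
    using assms(5-7) by (auto simp: supp_def)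
  have one: "\<bar>b r\<bar> = 1" "\<bar>b x\<bar> = 1" "\<bar>b p\<bar> = 1" "\<bar>c r\<bar> = 1" "\<bar>c y\<bar> = 1" "\<bar>c q\<bar> = 1"
    "\<bar>d x\<bar> = 1" "\<bar>d y\<bar> = 1" "\<bar>d i\<bar> = 1"
    using unit_row_abs[OF assms(2)] unit_row_abs[OF assms(3)] unit_row_abs[OF assms(4)] assms(5-7) by auto
  have zero: "b q = 0" "b i = 0" "c p = 0" "c i = 0" "d p = 0" "d q = 0"
    using I assms(5-8) by (auto simp: supp_def set_eq_iff)
  have rxy: "r \<noteq> x" "x \<noteq> r" "r \<noteq> y" "y \<noteq> r" "x \<noteq> y" "y \<noteq> x" using assms(8) by auto
  have d: "rsum I d X = rsum ?J d X" for X
  proof -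
    have "rsum I d X = rsum (I - {p}) d X" using assms(1) zero by (intro rsum_remove)
    also have "\<dots> = rsum (I - {p} - {q}) d X" using assms(1) zero by (intro rsum_remove) auto
    also have "I - {p} - {q} = ?J" by blast
    finally show ?thesis .
  qed
  have sK: "supp ?K b = {r, x}" "supp ?K c = {r, y}" "supp ?K d = {x, y}"
    unfolding supp_diff assms(5-7) using assms(8) by auto
  have rs: "rsum ?J b X = b r * sg X r + b x * sg X x" "rsum ?J c X = c r * sg X r + c y * sg X y"
    "rsum ?K d X = d x * sg X x + d y * sg X y" for X
    using rsum_remove[of ?J b i] rsum_remove[of ?J c i] fin zero assms(8)
      rsum_two[OF fin(2) sK(1)] rsum_two[OF fin(2) sK(2)] rsum_two[OF fin(2) sK(3)] by auto
  let ?F = "\<lambda>X. (3/4 - 1/4 * (b r * b x) * (sg X r * sg X x)) * (3/4 - 1/4 * (c r * c y) * (sg X r * sg X y))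
      * (3/4 - 1/4 * (d x * d y) * (sg X x * sg X y))"
  have "prob_on I (\<lambda>X. row_ok I b X \<and> row_ok I c X \<and> row_ok I d X)
      = avg I (\<lambda>X. of_bool (row_ok I d X) * of_bool (row_ok I b X) * of_bool (row_ok I c X))"
    by (intro avg_cong) auto
  also have "\<dots> = avg ?J (\<lambda>X. of_bool (row_ok I d X) * last_sign (rsum ?J b X) * last_sign (rsum ?J c X))"
    by (rule avg_two_last_signs[OF assms(1) I(4,5) one(3,6) zero(1,3)])
      (use assms(8) zero in \<open>simp_all add: row_ok_def rsum_insert_zero\<close>)
  also have "\<dots> = avg ?J (\<lambda>X. (last_sign (rsum ?J b X) * last_sign (rsum ?J c X)) * of_bool (row_ok ?J d X))"
    by (simp add: row_ok_def d mult_ac)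
  also have "\<dots> = avg ?K (\<lambda>X. (last_sign (rsum ?J b X) * last_sign (rsum ?J c X)) * last_sign (rsum ?K d X))"
    by (rule avg_last_sign[where b = d and i = i, OF fin(1) _ one(9)])
      (use assms(8) I zero in \<open>auto simp: rsum_insert_zero\<close>)
  also have "\<dots> = avg ?K ?F"
    unfolding rs using one by (simp add: last_sign_two)
  also have "\<dots> = avg {r, x, y} ?F"
    using I assms(8) by (intro avg_local[OF fin(2)]) (auto simp: sg_def)
  also have "\<dots> = 27/64 - (b r * b x) * (c r * c y) * (d x * d y) / 64"
    using rxy by (simp add: avg_insert sg_def field_simps)
  also have "\<dots> \<le> 7/16"
  proof -
    have "\<bar>(b r * b x) * (c r * c y) * (d x * d y)\<bar> = 1"
      using one by (simp add: abs_mult)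
    then show ?thesis by linarith
  qed
  finally show ?thesis .
qed

lemma opposed_iff:
  assumes "\<bar>c x\<bar> = 1" "\<bar>c y\<bar> = 1"
  shows "opposed c x y X \<longleftrightarrow> (c x * c y) * (sg X x * sg X y) = -1"
proof -
  have "c x = 1 \<or> c x = -1" "c y = 1 \<or> c y = -1" using assms by linarith+
  moreover have "sg X x = 1 \<or> sg X x = -1" "sg X y = 1 \<or> sg X y = -1" by (simp_all add: sg_def)
  ultimately show ?thesis by (elim disjE) (simp_all add: opposed_def)
qed

lemma supp_three_obtain:
  assumes "card (supp I c) = 3" "x \<in> supp I c" "y \<in> supp I c" "x \<noteq> y"
  obtains z where "supp I c = {x, y, z}" "y \<noteq> z" "x \<noteq> z"
proof -
  have "finite (supp I c)" using assms(1) card.infinite by force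
  then have "card (supp I c - {x, y}) = 1"
    using assms by (simp add: card_Diff_subset)
  then obtain z where "supp I c - {x, y} = {z}" by (auto simp: card_1_singleton_iff)
  then show ?thesis using that[of z] assms by blast
qed

lemma row_ok_opposed:
  assumes "finite I" "unit_row I c" "card (supp I c) = 3" "x \<in> supp I c" "y \<in> supp I c" "x \<noteq> y" "opposed c x y X"
  shows "row_ok I c X"
proof -
  obtain z where z: "supp I c = {x, y, z}" "y \<noteq> z" "x \<noteq> z"
    using supp_three_obtain[OF assms(3-6)] .
  show ?thesis
    using row_ok_three(1)[OF assms(1,2) z(1) assms(6) z(2,3)] assms(7) by simp
qed

text \<open>The two cancellation events exclude each other because the sign products differ. So if
  both rows hold, one of them holds without cancelling at \<open>x\<close>, \<open>y\<close>, and
  for each row this has probability \<open>3/4 - 1/2 = 1/4\<close>.\<close>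

lemma prob_three_conflict_le:
  assumes "finite I" "unit_row I b" "unit_row I c" "card (supp I b) = 3" "card (supp I c) = 3" "x \<noteq> y"
    and "{x, y} \<subseteq> supp I b" "{x, y} \<subseteq> supp I c" "b x * b y \<noteq> c x * c y"
  shows "prob_on I (\<lambda>X. row_ok I b X \<and> row_ok I c X) \<le> 1/2"
proof -
  have one: "\<bar>b x\<bar> = 1" "\<bar>b y\<bar> = 1" "\<bar>c x\<bar> = 1" "\<bar>c y\<bar> = 1" "x \<in> I"
    using unit_row_abs[OF assms(2)] unit_row_abs[OF assms(3)] assms(7,8) by (auto simp: supp_def)
  have excl: "\<not> (opposed b x y X \<and> opposed c x y X)" for X
  proof
    assume "opposed b x y X \<and> opposed c x y X"
    then have "(b x * b y) * (sg X x * sg X y) = (c x * c y) * (sg X x * sg X y)"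
      using opposed_iff[of b x y X, OF one(1,2)] opposed_iff[of c x y X, OF one(3,4)] by simp
    moreover have "sg X x * sg X y \<noteq> 0" by (simp add: sg_def)
    ultimately show False using assms(9) by simp
  qed
  have "prob_on I (\<lambda>X. row_ok I b X \<and> row_ok I c X)
      \<le> avg I (\<lambda>X. (of_bool (row_ok I b X) + -1 * of_bool (opposed b x y X))
        + (of_bool (row_ok I c X) + -1 * of_bool (opposed c x y X)))"
  proof (intro avg_mono)
    fix X
    show "of_bool (row_ok I b X \<and> row_ok I c X) \<le> (of_bool (row_ok I b X) + -1 * of_bool (opposed b x y X))
        + (of_bool (row_ok I c X) + -1 * of_bool (opposed c x y X) :: real)"
      using excl[of X] row_ok_opposed[OF assms(1,2,4) _ _ assms(6), of X]
        row_ok_opposed[OF assms(1,3,5) _ _ assms(6), of X] assms(7,8) by auto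
  qed
  also have "\<dots> = 1/2"
    unfolding avg_add avg_cmult prob_unit_row[OF assms(1,2)] prob_unit_row[OF assms(1,3)] assms(4,5)
      prob_opposed[of I x y b, OF assms(1) one(5) assms(6) one(1,2)]
      prob_opposed[of I x y c, OF assms(1) one(5) assms(6) one(3,4)] binavg_odd
    by simp
  finally show ?thesis .
qed

lemma good_pair: "good I {b, c} X \<longleftrightarrow> row_ok I b X \<and> row_ok I c X"
  by (auto simp: good_def)

lemma good_single: "good I {b} = row_ok I b"
  by (auto simp: good_def)

lemma prob_pair_outside_le:
  assumes "finite I" "card (supp I c - supp I b) \<ge> 2"
  shows "prob_on I (good I {b, c}) \<le> 3/4 * prob_on I (row_ok I b)"
  using prob_good_insert_outside[of I c "{b}"] assms by (simp add: insert_commute good_single)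

text \<open>With at most one common coordinate the factor 3/4 gives 9/16; with two common
  coordinates the exchange estimate gives 5/8.\<close>

lemma prob_two_three_le:
  assumes "finite I" "unit_row I b" "unit_row I c" "card (supp I b) = 3" "card (supp I c) = 3"
    and "supp I b \<noteq> supp I c"
  shows "prob_on I (good I {b, c}) \<le> 5/8"
proof (cases "card (supp I c - supp I b) \<ge> 2")
  case True
  then have "prob_on I (good I {b, c}) \<le> 3/4 * (3/4)"
    using prob_pair_outside_le[OF assms(1), of c b] prob_unit_row[OF assms(1,2)] binavg_odd(1) assms(4) by simp
  then show ?thesis by simp
next
  case False
  have fin: "finite (supp I b)" "finite (supp I c)" using assms(1) by (auto simp: supp_def)
  have "supp I c - supp I b \<noteq> {}" "supp I b - supp I c \<noteq> {}"
    using assms(4-6) fin by (metis Diff_eq_empty_iff card_subset_eq)+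
  then obtain i j where "i \<in> supp I b - supp I c" "j \<in> supp I c - supp I b" by blast
  then show ?thesis
    using prob_exchange_le[of I b c 2 i j] assms binavg_last_sign(1) by (simp add: good_pair)
qed

subsection \<open>The gap for systems of rows\<close>

lemma prob_unit_row_ge_5_le:
  assumes "finite I" "unit_row I b" "5 \<le> card (supp I b)"
  shows "prob_on I (row_ok I b) \<le> 5/8"
  using prob_unit_row_le[OF assms] by (simp add: binomial_fact fact_numeral)

lemma prob_five_outside_le:
  assumes "finite I" "unit_row I b" "5 \<le> card (supp I b)" "card (supp I c - supp I b) \<ge> 2"
  shows "prob_on I (good I {b, c}) \<le> 15/32"
  using prob_pair_outside_le[OF assms(1,4)] prob_unit_row_ge_5_le[OF assms(1-3)] by simp

text \<open>The separating pattern \<open>X\<close> rules out rows that agree up to a global sign.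
  If the supports differ, the exchange estimate gives 55/128 or 49/128. If they coincide, some
  coefficient agrees and another is opposite, and the conflict estimate gives 5/16 or
  35/128.\<close>

lemma prob_same_size_le:
  assumes "finite I" "unit_row I b" "unit_row I c" "card (supp I b) = n" "card (supp I c) = n" "n = 7 \<or> n = 9"
    and "X \<subseteq> I" "row_ok I b X \<noteq> row_ok I c X"
  shows "prob_on I (good I {b, c}) \<le> 15/32"
proof -
  have fin: "finite (supp I b)" "finite (supp I c)" using assms(1) by (auto simp: supp_def)
  show ?thesis
  proof (cases "supp I b = supp I c")
    case False
    then have "supp I c - supp I b \<noteq> {}" "supp I b - supp I c \<noteq> {}"
      using assms(4,5) fin by (metis Diff_eq_empty_iff card_subset_eq)+
    then obtain i j where ij: "i \<in> supp I b - supp I c" "j \<in> supp I c - supp I b" by blast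
    have "prob_on I (good I {b, c}) \<le> binavg (n - 1) (\<lambda>s. last_sign s ^ 2)"
      unfolding good_pair
      using assms(4-6) ij by (intro prob_exchange_le[OF assms(1-3)]) auto
    also have "\<dots> \<le> 15/32"
      using assms(6) binavg_last_sign(2,3) by auto
    finally show ?thesis .
  next
    case True
    have "\<bar>b j\<bar> = 1" "\<bar>c j\<bar> = 1" if "j \<in> supp I b" for j
      using unit_row_abs[OF assms(2)] unit_row_abs[OF assms(3)] that True by auto
    then have eq_or: "c j = b j \<or> c j = - b j" if "j \<in> supp I b" for j
      using that by (metis abs_eq_iff)
    have zero: "b j = 0" "c j = 0" if "j \<in> I" "j \<notin> supp I b" for j
      using that True by (auto simp: supp_def)
    have "\<exists>i\<in>supp I b. c i \<noteq> - b i"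
    proof (rule ccontr)
      assume "\<not> ?thesis"
      then have "rsum I c X = - rsum I b X"
        unfolding rsum_def sum_negf[symmetric] using zero by (intro sum.cong) force+
      then show False using assms(8) by (simp add: row_ok_def)
    qed
    then obtain i where i: "i \<in> supp I b" "c i \<noteq> - b i" by blast
    have "\<exists>j\<in>supp I b. c j \<noteq> b j"
    proof (rule ccontr)
      assume "\<not> ?thesis"
      then have "rsum I c X = rsum I b X"
        unfolding rsum_def using zero by (intro sum.cong) force+
      then show False using assms(8) by (simp add: row_ok_def)
    qed
    then obtain j where j: "j \<in> supp I b" "c j \<noteq> b j" by blast
    have "prob_on I (good I {b, c}) \<le> 1/2 * binavg (card (supp I b) - 2) (\<lambda>s. of_bool (\<bar>s\<bar> = 1))"
      unfolding good_pair
      using i j eq_or[OF i(1)] eq_or[OF j(1)] True by (intro prob_sign_conflict_le[OF assms(1-3), of i j]) auto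
    also have "\<dots> \<le> 15/32"
      using assms(4,6) binavg_odd(2,3) by auto
    finally show ?thesis .
  qed
qed

text \<open>Any row not equivalent to \<open>b\<close> would bring the probability down to 15/32, so
  the system reduces to the single row \<open>b\<close>.\<close>

lemma prob_large_row:
  assumes "finite I" "\<And>b. b \<in> R \<Longrightarrow> unit_row I b" "\<And>b. b \<in> R \<Longrightarrow> card (supp I b) \<in> {3, 5, 7, 9}"
    and "b \<in> R" "card (supp I b) \<ge> 7" "prob_on I (good I R) > 15/32"
  shows "prob_on I (good I R) = 35/64 \<or> prob_on I (good I R) = 63/128"
proof -
  have fin: "finite (supp I c)" for c using assms(1) by (auto simp: supp_def)
  have pair: "prob_on I (good I {b, c}) > 15/32" if "c \<in> R" for c
    using prob_good_antimono[of "{b, c}" R I] that assms(4,6) by auto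
  have "row_ok I c X = row_ok I b X" if c: "c \<in> R" and X: "X \<subseteq> I" for c X
  proof (rule ccontr)
    assume neq: "row_ok I c X \<noteq> row_ok I b X"
    have "card (supp I c) \<noteq> 3"
      using prob_three_seven_le[OF assms(1) assms(2)[OF assms(4)] assms(2)[OF c] assms(5)] pair[OF c]
      by (auto simp: good_pair)
    then have c5: "card (supp I c) \<in> {5, 7, 9}" using assms(3)[OF c] by auto
    have d: "card (supp I c - supp I b) < 2" "card (supp I b - supp I c) < 2"
      using prob_five_outside_le[OF assms(1) assms(2)[OF assms(4)], of c] assms(5)
        prob_five_outside_le[OF assms(1) assms(2)[OF c], of b] c5 pair[OF c]
      by (force simp: insert_commute)+
    \<comment> \<open>The two sizes differ by at most one and are both odd, hence equal.\<close>
    have "card (supp I b) + card (supp I c - supp I b) = card (supp I c) + card (supp I b - supp I c)"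
      using card_Un_disjoint[of "supp I b" "supp I c - supp I b"] card_Un_disjoint[of "supp I c" "supp I b - supp I c"] fin
      by (simp add: Un_commute)
    then have "card (supp I b) = card (supp I c) \<and> (card (supp I b) = 7 \<or> card (supp I b) = 9)"
      using d c5 assms(5) assms(3)[OF assms(4)] by auto
    then show False
      using prob_same_size_le[OF assms(1) assms(2)[OF assms(4)] assms(2)[OF c] refl _ _ X] neq pair[OF c] by force
  qed
  then have "good I R X \<longleftrightarrow> row_ok I b X" if "X \<subseteq> I" for X
    using assms(4) that unfolding good_def by blast
  then have "prob_on I (good I R) = prob_on I (row_ok I b)"
    by (intro avg_cong) simp
  then show ?thesis
    using assms(3)[OF assms(4)] assms(5) binavg_odd(3,4) unfolding prob_unit_row[OF assms(1) assms(2)[OF assms(4)]]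
    by auto
qed

section \<open>Systems with rows of size five and three\<close>

lemma card_ge_2_obtain:
  assumes "card A \<ge> 2"
  obtains x y where "x \<in> A" "y \<in> A" "x \<noteq> y"
proof -
  obtain B where B: "B \<subseteq> A" "card B = 2" using obtain_subset_with_card_n[OF assms] by metis
  then obtain x y where "B = {x, y}" "x \<noteq> y" by (auto simp: card_2_iff)
  then show ?thesis using B that by auto
qed

lemma card_lt_2_eq: "finite A \<Longrightarrow> card A < 2 \<Longrightarrow> x \<in> A \<Longrightarrow> A = {x}"
  by (metis One_nat_def card_1_singletonE card_gt_0_iff empty_iff less_2_cases less_numeral_extra(3) singletonD)

text \<open>Rows reaching two different coordinates outside the support of \<open>b\<close> would
  force probability at most 7/16, so at most six coordinates occur in total.\<close>

lemma prob_five_row: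
  assumes "finite I" "\<And>b. b \<in> R \<Longrightarrow> unit_row I b" "\<And>b. b \<in> R \<Longrightarrow> card (supp I b) = 3 \<or> card (supp I b) = 5"
    and "b \<in> R" "card (supp I b) = 5" "prob_on I (good I R) > 15/32"
  shows "\<exists>n::nat. prob_on I (good I R) = n / 2 ^ 5"
proof -
  let ?B = "supp I b" and ?O = "\<Union>c\<in>R. supp I c - supp I b"
  have fin: "finite (supp I c)" for c using assms(1) by (auto simp: supp_def)
  have finO: "finite ?O" by (rule finite_subset[OF _ assms(1)]) (auto simp: supp_def)
  have out: "card (supp I c - ?B) < 2" if "c \<in> R" for c
    using prob_five_outside_le[OF assms(1) assms(2)[OF assms(4)], of c] assms(5,6)
      prob_good_antimono[of "{b, c}" R I] that assms(4) by force
  have "card ?O < 2"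
  proof (rule ccontr)
    assume "\<not> card ?O < 2"
    then have "card ?O \<ge> 2" by (simp only: not_less)
    then obtain i j where ij: "i \<in> ?O" "j \<in> ?O" "i \<noteq> j" by (rule card_ge_2_obtain)
    then obtain c d where cd: "c \<in> R" "i \<in> supp I c - ?B" "d \<in> R" "j \<in> supp I d - ?B" by blast
    have "supp I c - ?B = {i}" "supp I d - ?B = {j}"
      by (rule card_lt_2_eq[OF finite_Diff[OF fin] out[OF cd(1)] cd(2)])
        (rule card_lt_2_eq[OF finite_Diff[OF fin] out[OF cd(3)] cd(4)])
    moreover from this have "i \<notin> supp I d" "j \<notin> supp I c" using ij(3) cd(2,4) by auto
    ultimately have "prob_on I (\<lambda>X. row_ok I b X \<and> row_ok I c X \<and> row_ok I d X) \<le> 7/16"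
      using assms(3)[OF cd(1)] assms(3)[OF cd(3)] ij(3)
      by (intro prob_five_two_outside_le[OF assms(1) assms(2)[OF assms(4)] assms(2)[OF cd(1)] assms(2)[OF cd(3)] assms(5)])
    moreover have "prob_on I (good I R) \<le> prob_on I (\<lambda>X. row_ok I b X \<and> row_ok I c X \<and> row_ok I d X)"
      using cd assms(4) by (intro prob_on_mono) (auto simp: good_def)
    ultimately show False using assms(6) by simp
  qed
  then have "card (?B \<union> ?O) \<le> Suc 5"
    using card_Un_le[of ?B ?O] assms(5) by linarith
  moreover have "?B \<union> ?O = \<Union>(supp I ` R)" using assms(4) by blast
  ultimately have "card (\<Union>(supp I ` R)) \<le> Suc 5" by (simp only:)
  then show ?thesis by (rule prob_good_granular[OF assms(1)])
qed

text \<open>\<open>D\<close> meets both \<open>B - C\<close> and \<open>C - B\<close>, since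
  otherwise one of them would keep two private elements. Together with \<open>i\<close> this
  exhausts \<open>D\<close>, and counting private elements again leaves exactly one common element
  of \<open>B\<close> and \<open>C\<close>.\<close>

lemma triangle_obtain:
  assumes "card B = 3" "card C = 3" "card D = 3" "card (C - B) \<ge> 2"
    and "i \<in> D" "i \<notin> B" "i \<notin> C" "card (B - (C \<union> D)) < 2" "card (C - (B \<union> D)) < 2"
  obtains r x y p q where "B = {r, x, p}" "C = {r, y, q}" "D = {x, y, i}" "distinct [r, x, y, p, q, i]"
proof -
  have fin: "finite B" "finite C" "finite D" using assms(1-3) card.infinite by force+
  have "card (B - C) + card (B \<inter> C) = 3" "card (C - B) + card (C \<inter> B) = 3"
    using card_Diff_subset_Int[of B C] card_Diff_subset_Int[of C B] fin assms(1,2)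
      card_mono[of B "B \<inter> C"] card_mono[of C "C \<inter> B"] by auto
  then have BC: "card (B - C) \<ge> 2" "card (B - C) + card (B \<inter> C) = 3"
    using assms(4) by (auto simp: Int_commute)
  have "\<not> B - C \<subseteq> B - (C \<union> D)" "\<not> C - B \<subseteq> C - (B \<union> D)"
    using card_mono[of "B - (C \<union> D)" "B - C"] card_mono[of "C - (B \<union> D)" "C - B"] fin assms(4,8,9) BC by auto
  then obtain x y where xy: "x \<in> B - C" "x \<in> D" "y \<in> C - B" "y \<in> D" by blast
  have "x \<noteq> y" "y \<noteq> i" "x \<noteq> i" using xy assms(6,7) by auto
  then have "{x, y, i} \<subseteq> D" "card {x, y, i} = card D" using xy assms(3,5) by simp_all
  then have D: "D = {x, y, i}" using fin card_subset_eq by metis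
  then have "B - (C \<union> D) = (B - C) - {x}" using assms(6) xy by auto
  then have "card (B - C) \<le> 2" using assms(8) xy fin by (simp add: card_Diff_singleton_if)
  then have "card (B \<inter> C) = 1" using BC by simp
  then obtain r where r: "B \<inter> C = {r}" by (auto simp: card_1_singleton_iff)
  have rB: "{r, x} \<subseteq> B" "r \<noteq> x" "{r, y} \<subseteq> C" "r \<noteq> y" using r xy by auto
  have "card (B - {r, x}) = 1" "card (C - {r, y}) = 1"
    using rB assms(1,2) by (simp_all add: card_Diff_subset)
  then obtain p q where pq: "B - {r, x} = {p}" "C - {r, y} = {q}" by (auto simp: card_1_singleton_iff)
  have "B = {r, x, p}" "C = {r, y, q}" using pq rB by auto
  moreover have "distinct [r, x, y, p, q, i]"
  proof -
    have "p \<in> B" "q \<in> C" "p \<noteq> r" "p \<noteq> x" "q \<noteq> r" "q \<noteq> y" using pq by auto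
    moreover from this have "p \<notin> C" "q \<notin> B" using r by auto
    ultimately show ?thesis using xy r assms(6,7) rB by auto
  qed
  ultimately show ?thesis using D that by blast
qed

text \<open>A row leaving the supports of \<open>b\<close> and \<open>c\<close> either forms a
  triangle with them, or \<open>b\<close> or \<open>c\<close> has two coordinates outside the other
  two rows. Both contradict the lower bound, so at most six coordinates occur.\<close>

lemma prob_three_rows_far:
  assumes "finite I" "\<And>b. b \<in> R \<Longrightarrow> unit_row I b" "\<And>b. b \<in> R \<Longrightarrow> card (supp I b) = 3"
    and "b \<in> R" "c \<in> R" "card (supp I c - supp I b) \<ge> 2" "prob_on I (good I R) > 15/32"
  shows "\<exists>n::nat. prob_on I (good I R) = n / 2 ^ 5"
proof -
  let ?B = "supp I b" and ?C = "supp I c"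
  have fin: "finite (supp I d)" for d using assms(1) by (auto simp: supp_def)
  note un = assms(2)[OF assms(4)] assms(2)[OF assms(5)] and B3 = assms(3)[OF assms(4)] and C3 = assms(3)[OF assms(5)]
  have low: "prob_on I (good I R') > 15/32" if "R' \<subseteq> R" for R'
    using prob_good_antimono[OF that, of I] assms(7) by simp
  have bc: "prob_on I (good I {b, c}) \<le> 5/8"
    using prob_two_three_le[OF assms(1) un B3 C3] assms(6) by force
  have "supp I d \<subseteq> ?B \<union> ?C" if d: "d \<in> R" for d
  proof (rule ccontr)
    assume "\<not> ?thesis"
    then obtain i where i: "i \<in> supp I d" "i \<notin> ?B" "i \<notin> ?C" by blast
    note D3 = assms(3)[OF d] and und = assms(2)[OF d]
    \<comment> \<open>The factor 3/4 on top of 5/8 is exactly 15/32, which the strict hypothesis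
      excludes.\<close>
    have outside: False if "card (supp I r - (supp I s \<union> supp I t)) \<ge> 2" "prob_on I (good I {s, t}) \<le> 5/8"
      "{r, s, t} \<subseteq> R" for r s t
      using prob_good_insert_outside[OF assms(1), of r "{s, t}"] that(1,2) low[OF that(3)] by simp
    have "prob_on I (good I {c, d}) \<le> 5/8"
      using i C3 D3 un(2) und by (intro prob_two_three_le[OF assms(1)]) auto
    then have far1: "card (?B - (?C \<union> supp I d)) < 2"
      using outside[of b c d] assms(4,5) d by force
    have "prob_on I (good I {b, d}) \<le> 5/8"
      using i B3 D3 un(1) und by (intro prob_two_three_le[OF assms(1)]) auto
    then have far2: "card (?C - (?B \<union> supp I d)) < 2"
      using outside[of c b d] assms(4,5) d by force
    obtain r x y p q where tri: "?B = {r, x, p}" "?C = {r, y, q}" "supp I d = {x, y, i}" "distinct [r, x, y, p, q, i]"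
      by (rule triangle_obtain[OF B3 C3 D3 assms(6) i far1 far2])
    have "prob_on I (good I R) \<le> prob_on I (\<lambda>X. row_ok I b X \<and> row_ok I c X \<and> row_ok I d X)"
      using assms(4,5) d by (intro prob_on_mono) (auto simp: good_def)
    then show False
      using prob_triangle_le[OF assms(1) un und tri] assms(7) by simp
  qed
  then have "\<Union>(supp I ` R) \<subseteq> ?B \<union> ?C" by blast
  then have "card (\<Union>(supp I ` R)) \<le> card (?B \<union> ?C)"
    using fin by (intro card_mono) auto
  also have "\<dots> \<le> Suc 5" using card_Un_le[of ?B ?C] B3 C3 by simp
  finally show ?thesis by (rule prob_good_granular[OF assms(1)])
qed

lemma three_subset_insert:
  assumes "card A = 3" "i \<in> A" "A - B \<subseteq> {i}"  "i \<notin> B"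
  shows "card (A \<inter> B) = 2"
proof -
  have "finite A" using assms(1) card.infinite by force
  moreover have "A \<inter> B = A - {i}" using assms by auto
  ultimately show ?thesis using assms(1,2) by simp
qed

text \<open>Two sets that leave \<open>B\<close> at different points meet only inside
  \<open>B\<close>, hence both meet \<open>B\<close> in the same pair. Any further set other than
  \<open>B\<close> leaves \<open>B\<close> at a point missing from one of these two, so the same
  argument puts the pair into it.\<close>

lemma common_pair:
  assumes "\<And>A. A \<in> F \<Longrightarrow> card A = 3" "\<And>A A'. A \<in> F \<Longrightarrow> A' \<in> F \<Longrightarrow> card (A - A') < 2"
    and "B \<in> F" "finite (\<Union>F)" "card (\<Union>F) \<ge> 5"
  obtains x y where "x \<noteq> y" "\<And>A. A \<in> F \<Longrightarrow> {x, y} \<subseteq> A"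
proof -
  have fin: "finite A" if "A \<in> F" for A using assms(1)[OF that] card.infinite by force
  have only: "A - A' = {i}" if "A \<in> F" "A' \<in> F" "i \<in> A" "i \<notin> A'" for A A' i
    using card_lt_2_eq[of "A - A'" i] assms(2)[OF that(1,2)] fin[OF that(1)] that by simp
  have two: "card (A \<inter> A') = 2" if "A \<in> F" "A' \<in> F" "i \<in> A" "i \<notin> A'" for A A' i
    using three_subset_insert[of A i A'] only[OF that] assms(1)[OF that(1)] that by simp
  have "card (\<Union>F - B) \<ge> 2"
    using assms(1)[OF assms(3)] assms(3-5) by (subst card_Diff_subset) (auto simp: fin)
  then obtain i j where ij: "i \<in> \<Union>F - B" "j \<in> \<Union>F - B" "i \<noteq> j" by (rule card_ge_2_obtain)
  then obtain C D where CD: "C \<in> F" "i \<in> C" "i \<notin> B" "D \<in> F" "j \<in> D" "j \<notin> B" by blast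
  then have CB: "C - B = {i}" and DB: "D - B = {j}" using only assms(3) by auto
  obtain x y where xy: "C \<inter> B = {x, y}" "x \<noteq> y"
    using two[OF CD(1) assms(3) CD(2,3)] by (auto simp: card_2_iff)
  have jC: "j \<notin> C" using CB CD(6) ij(3) by auto
  have "D \<inter> C - B \<subseteq> {i} \<inter> {j}" unfolding CB[symmetric] DB[symmetric] by blast
  then have "D \<inter> C \<subseteq> C \<inter> B" using ij(3) by blast
  then have "D \<inter> C \<subseteq> {x, y}" unfolding xy(1) .
  moreover have "card (D \<inter> C) = card {x, y}" using two[OF CD(4,1,5) jC] xy(2) by simp
  ultimately have DC: "D \<inter> C = {x, y}" by (intro card_subset_eq) auto
  have DBxy: "D \<inter> B = {x, y}"
  proof -
    have "{x, y} \<subseteq> D \<inter> B" using DC xy(1) by blast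
    moreover have "card {x, y} = card (D \<inter> B)" using two[OF CD(4) assms(3) CD(5,6)] xy(2) by simp
    ultimately show ?thesis using fin[OF assms(3)] by (intro card_subset_eq[symmetric]) auto
  qed
  have "{x, y} \<subseteq> A" if A: "A \<in> F" for A
  proof (cases "A \<subseteq> B")
    case True
    then have "A = B" using card_subset_eq[OF fin[OF assms(3)]] assms(1)[OF A] assms(1)[OF assms(3)] by simp
    then show ?thesis using xy by auto
  next
    case False
    then obtain k where k: "k \<in> A" "k \<notin> B" by blast
    have AB: "A - B = {k}" using only[OF A assms(3) k] .
    have sub: "{x, y} \<subseteq> A" if E: "E \<in> F" "E \<inter> B = {x, y}" "k \<notin> E" for E
    proof -
      have "A - E = {k}" using only[OF A E(1) k(1) E(3)] .
      then have "A \<inter> E \<subseteq> E \<inter> B" using AB E(3) by blast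
      then have "A \<inter> E \<subseteq> {x, y}" unfolding E(2) .
      moreover have "card (A \<inter> E) = card {x, y}" using two[OF A E(1) k(1) E(3)] xy(2) by simp
      ultimately have "A \<inter> E = {x, y}" by (intro card_subset_eq) auto
      then show ?thesis by blast
    qed
    show ?thesis
    \<comment> \<open>Since \<open>i\<close> and \<open>j\<close> differ, at least one of
      \<open>C\<close> and \<open>D\<close> avoids \<open>k\<close>.\<close>
    proof (cases "k = i")
      case True
      then have "k \<notin> D" using DB CD(3) ij(3) by auto
      then show ?thesis using sub[OF CD(4) DBxy] by simp
    next
      case False
      then have "k \<notin> C" using CB k(2) by auto
      then show ?thesis using sub[OF CD(1) xy(1)] by simp
    qed
  qed
  then show ?thesis using that xy(2) by blast
qed

text \<open>Beyond six coordinates all rows share a pair. Equal sign products there let its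
  cancellation satisfy every row, which gives at least 1/2; a conflict gives two rows on few
  coordinates with probability at most 1/2, where the half gap applies.\<close>

lemma prob_three_rows_near:
  assumes "finite I" "\<And>b. b \<in> R \<Longrightarrow> unit_row I b" "\<And>b. b \<in> R \<Longrightarrow> card (supp I b) = 3"
    and "\<And>b c. b \<in> R \<Longrightarrow> c \<in> R \<Longrightarrow> card (supp I c - supp I b) < 2"
  shows "(\<exists>n::nat. prob_on I (good I R) = n / 2 ^ 5) \<or> prob_on I (good I R) \<ge> 1/2
    \<or> prob_on I (good I R) \<le> 15/32"
proof (cases "card (\<Union>(supp I ` R)) \<le> Suc 5")
  case True
  then show ?thesis using prob_good_granular[OF assms(1)] by blast
next
  case False
  have fin: "finite (supp I d)" for d using assms(1) by (auto simp: supp_def)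
  have "R \<noteq> {}" using False by auto
  then obtain b where b: "b \<in> R" by blast
  have finU: "finite (\<Union>(supp I ` R))" by (rule finite_subset[OF _ assms(1)]) (auto simp: supp_def)
  obtain x y where xy: "x \<noteq> y" "\<And>A. A \<in> supp I ` R \<Longrightarrow> {x, y} \<subseteq> A"
    by (rule common_pair[of "supp I ` R" "supp I b"]) (use assms(3,4) b finU False in auto)
  have inc: "x \<in> supp I c" "y \<in> supp I c" if "c \<in> R" for c using xy(2) that by auto
  have abs: "\<bar>c x\<bar> = 1" "\<bar>c y\<bar> = 1" if "c \<in> R" for c
    using unit_row_abs[OF assms(2)[OF that]] inc[OF that] by auto
  show ?thesis
  proof (cases "\<forall>c\<in>R. c x * c y = b x * b y")
    case True
    have "row_ok I c X" if "c \<in> R" "opposed b x y X" for c X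
    proof -
      have "opposed c x y X"
        using that True opposed_iff[of c x y X, OF abs[OF that(1)]] opposed_iff[of b x y X, OF abs[OF b]] by simp
      then show ?thesis
        using row_ok_opposed[OF assms(1) assms(2)[OF that(1)] assms(3)[OF that(1)] inc[OF that(1)] xy(1)] by simp
    qed
    then have "prob_on I (opposed b x y) \<le> prob_on I (good I R)"
      by (intro prob_on_mono) (auto simp: good_def)
    moreover have "x \<in> I" using inc[OF b] by (simp add: supp_def)
    ultimately show ?thesis
      using prob_opposed[of I x y b, OF assms(1) _ xy(1) abs[OF b]] by simp
  next
    case False
    then obtain c where c: "c \<in> R" "b x * b y \<noteq> c x * c y" by force
    have "prob_on I (good I {b, c}) \<le> 1/2"
      unfolding good_pair using inc b c assms(2,3) xy(1) by (intro prob_three_conflict_le[OF assms(1), of b c x y]) auto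
    moreover have "card (\<Union>(supp I ` {b, c})) \<le> 5"
      using card_Un_disjoint[of "supp I b" "supp I c - supp I b"] fin assms(3)[OF b] assms(4)[OF b c(1)] by (simp add: Un_commute)
    ultimately have "prob_on I (good I R) \<le> 15/32 \<or> prob_on I (good I R) = 1/2"
      using b c(1) by (intro prob_le_half_gap[OF assms(1)]) auto
    then show ?thesis by auto
  qed
qed

theorem prob_good_gap:
  assumes "finite I"
  shows "prob_on I (good I R) \<le> 15/32 \<or> prob_on I (good I R) = 63/128 \<or> prob_on I (good I R) \<ge> 1/2"
proof (rule ccontr)
  assume neg: "\<not> ?thesis"
  then have low: "prob_on I (good I R) > 15/32" and high: "prob_on I (good I R) < 1/2"
    and ne: "prob_on I (good I R) \<noteq> 63/128" by auto
  have single: "prob_on I (row_ok I b) > 15/32" if "b \<in> R" for b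
    using prob_good_antimono[of "{b}" R I] that low by (simp add: good_single)
  have unit: "unit_row I b" if b: "b \<in> R" for b
  proof (rule ccontr)
    assume "\<not> unit_row I b"
    then obtain j where j: "j \<in> I" "b j \<noteq> 0" "\<bar>b j\<bar> \<noteq> 1" by (auto simp: unit_row_def)
    \<comment> \<open>Six coordinates would give at most 15/32; with at most five, the half gap
      excludes everything strictly between 15/32 and 1/2.\<close>
    then have "card (supp I b) \<le> 5"
      using prob_nonunit_row_le(2)[of I j b, OF assms j] single[OF b] by force
    then show False
      using prob_le_half_gap[OF assms, of "{b}" R] prob_nonunit_row_le(1)[of I j b, OF assms j] b neg
      by (simp add: good_single)
  qed
  have size: "card (supp I b) \<in> {1, 3, 5, 7, 9}" if b: "b \<in> R" for b
  proof -
    have "odd (card (supp I b))"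
      using prob_unit_row_even[OF assms unit[OF b]] single[OF b] by force
    moreover have "card (supp I b) < 10"
    proof (rule ccontr)
      assume "\<not> card (supp I b) < 10"
      \<comment> \<open>Ten signs already give \<open>462/1024 < 15/32\<close>.\<close>
      then have "prob_on I (row_ok I b) \<le> real (Suc 10 choose (Suc 10 div 2)) / 2 ^ 10"
        by (intro prob_unit_row_le[OF assms unit[OF b]]) simp
      then show False using single[OF b] by (simp add: binomial_fact fact_numeral)
    qed
    ultimately show ?thesis by (auto elim!: oddE)
  qed
  \<comment> \<open>A row with a single unit coefficient holds for every pattern, so
    \<open>S\<close> describes the same event.\<close>
  define S where "S = {b \<in> R. card (supp I b) \<noteq> 1}"
  have trivial: "row_ok I b X" if "b \<in> R" "b \<notin> S" for b X
  proof -
    have "card (supp I b) = 1" using that by (simp add: S_def)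
    then obtain j where j: "supp I b = {j}" by (rule card_1_singletonE)
    have "rsum I b X = (\<Sum>j\<in>supp I b. b j * sg X j)"
      using assms unfolding rsum_def by (intro sum.mono_neutral_right) (auto simp: supp_def)
    then show ?thesis
      using j unit_row_abs[OF unit[OF that(1)], of j] by (simp add: row_ok_def abs_mult sg_def)
  qed
  have RS: "good I R X \<longleftrightarrow> good I S X" for X
    using trivial by (auto simp: good_def S_def)
  have S: "unit_row I b" "card (supp I b) \<in> {3, 5, 7, 9}" if "b \<in> S" for b
    using that unit size[of b] by (auto simp: S_def)
  note neg' = neg[unfolded RS] low[unfolded RS] high[unfolded RS] ne[unfolded RS]
  \<comment> \<open>No multiple of 1/32 lies strictly between 15/32 and 16/32.\<close>
  have granular: False if "\<exists>n::nat. prob_on I (good I S) = n / 2 ^ 5"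
  proof -
    from that obtain n :: nat where n: "prob_on I (good I S) = n / 2 ^ 5" by (rule exE)
    then have "real n > 15" "real n < 16" using neg'(2,3) by auto
    then show False by simp
  qed
  have small: "card (supp I b) \<in> {3, 5}" if "b \<in> S" for b
    using prob_large_row[OF assms S that] S(2)[OF that] neg' by fastforce
  have three: "card (supp I b) = 3" if "b \<in> S" for b
    using prob_five_row[OF assms S(1), of S b] small[OF that] small that neg'(2) granular by fastforce
  show False
  proof (cases "\<exists>b\<in>S. \<exists>c\<in>S. card (supp I c - supp I b) \<ge> 2")
    case True
    then show False using prob_three_rows_far[OF assms S(1) three] neg'(2) granular by blast
  next
    case False
    then have "card (supp I c - supp I b) < 2" if "b \<in> S" "c \<in> S" for b c
      using that by (meson not_less)
    then have "(\<exists>n::nat. prob_on I (good I S) = n / 2 ^ 5) \<or> prob_on I (good I S) \<ge> 1/2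
        \<or> prob_on I (good I S) \<le> 15/32"
      by (intro prob_three_rows_near[OF assms S(1) three])
    then show False
    proof (elim disjE)
      assume "\<exists>n::nat. prob_on I (good I S) = n / 2 ^ 5"
      then show False by (rule granular)
    qed (use neg'(2,3) in simp_all)
  qed
qed

subsection \<open>Subspaces and the Boolean cube\<close>

definition indicator_point :: "nat set \<Rightarrow> nat \<Rightarrow> real" where
  "indicator_point X j = (if j \<in> X then 1 else 0)"

lemma cube_eq_image: "cube k = indicator_point ` Pow {..<k}"
proof (intro equalityI subsetI)
  fix x assume x: "x \<in> cube k"
  have "x = indicator_point {j. x j = 1}"
  proof
    fix j show "x j = indicator_point {j. x j = 1} j"
      using x by (cases "j < k") (auto simp: cube_def indicator_point_def)
  qed
  moreover have "{j. x j = 1} \<in> Pow {..<k}"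
    using x by (auto simp: cube_def) (metis not_less zero_neq_one)
  ultimately show "x \<in> indicator_point ` Pow {..<k}" by blast
qed (auto simp: cube_def indicator_point_def)

lemma inj_indicator_point: "inj indicator_point"
proof (rule injI)
  fix X Y assume eq: "indicator_point X = indicator_point Y"
  have "j \<in> X \<longleftrightarrow> j \<in> Y" for j
    using fun_cong[OF eq, of j] by (simp add: indicator_point_def split: if_splits)
  then show "X = Y" by blast
qed

lemma sum_indicator_point:
  "X \<subseteq> {..<k} \<Longrightarrow> (\<Sum>j<k. a j * indicator_point X j) = sum a X"
  unfolding indicator_point_def
  by (simp add: if_distrib sum.inter_restrict[symmetric] Int_absorb1 cong: if_cong)

text \<open>The coefficient at the extra coordinate \<open>k\<close> is chosen so that, with sign 1
  there, the row values 0 and 1 become the signed sums -1 and 1.\<close>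

definition hom_row :: "nat \<Rightarrow> (nat \<Rightarrow> real) \<Rightarrow> nat \<Rightarrow> real" where
  "hom_row k a j = (if j = k then sum a {..<k} - 1 else a j)"

lemma rsum_hom_row:
  assumes "X \<subseteq> {..<k}"
  shows "rsum {..k} (hom_row k a) (insert k X) = 2 * sum a X - 1"
proof -
  have "rsum {..k} (hom_row k a) (insert k X) = (\<Sum>j<k. a j * sg X j) + (sum a {..<k} - 1)"
    unfolding lessThan_Suc_atMost[symmetric] rsum_def sum.lessThan_Suc
    by (auto simp: hom_row_def sg_def intro!: sum.cong)
  also have "(\<Sum>j<k. a j * sg X j) = (\<Sum>j<k. 2 * (a j * indicator_point X j) - a j)"
    by (intro sum.cong) (auto simp: sg_def indicator_point_def)
  also have "\<dots> = 2 * sum a X - sum a {..<k}"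
    unfolding sum_subtractf sum_distrib_left[symmetric] sum_indicator_point[OF assms] ..
  finally show ?thesis by simp
qed

text \<open>Points of the cube are the sign patterns with sign 1 at \<open>k\<close>; complement
  symmetry replaces them by all patterns on \<open>k + 1\<close> coordinates.\<close>

lemma card_cube_eq_prob:
  fixes A :: "nat \<Rightarrow> nat \<Rightarrow> real"
  shows "real (card {x \<in> cube k. \<forall>i<m. (\<Sum>j<k. A i j * x j) = 0 \<or> (\<Sum>j<k. A i j * x j) = 1})
    = 2 ^ k * prob_on {..k} (good {..k} ((\<lambda>i. hom_row k (A i)) ` {..<m}))"
proof -
  let ?G = "good {..k} ((\<lambda>i. hom_row k (A i)) ` {..<m})"
  let ?P = "\<lambda>x. \<forall>i<m. (\<Sum>j<k. A i j * x j) = 0 \<or> (\<Sum>j<k. A i j * x j) = 1"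
  have iff: "?P (indicator_point X) \<longleftrightarrow> ?G (insert k X)" if "X \<in> Pow {..<k}" for X
  proof -
    have "\<bar>2 * s - 1\<bar> = 1 \<longleftrightarrow> s = 0 \<or> s = 1" for s :: real by linarith
    then show ?thesis
      using that by (auto simp: good_def row_ok_def rsum_hom_row sum_indicator_point)
  qed
  have "{x \<in> cube k. ?P x} = indicator_point ` {X \<in> Pow {..<k}. ?G (insert k X)}"
    unfolding cube_eq_image using iff by blast
  then have "card {x \<in> cube k. ?P x} = card {X \<in> Pow {..<k}. ?G (insert k X)}"
    by (simp add: card_image inj_on_subset[OF inj_indicator_point])
  also have "real \<dots> = (\<Sum>X\<in>Pow {..<k}. of_bool (?G (insert k X)))"
    by (simp add: Int_def flip: of_nat_sum)
  also have "\<dots> = 2 ^ k * avg ({..k} - {k}) (\<lambda>X. of_bool (?G (insert k X)))"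
  proof -
    have "{..k} - {k} = {..<k}" by auto
    then show ?thesis by (simp add: avg_def)
  qed
  also have "\<dots> = 2 ^ k * prob_on {..k} ?G"
    using avg_symmetric(2)[of "{..k}" k "\<lambda>X. of_bool (?G X)"] by (simp add: good_compl)
  finally show ?thesis .
qed

text \<open>Witness: row 0 has \<open>p\<close> entries -1 and \<open>n - p\<close> entries 1, and
  all other rows vanish, so they always take the value 0. Flipping the first \<open>p\<close>
  coordinates turns the condition into having \<open>p\<close> or \<open>p + 1\<close> ones among
  \<open>n\<close>.\<close>

lemma card_single_row_mem_Hset:
  assumes "m \<ge> 1" "n \<le> k" "p \<le> n"
  shows "((n choose p) + (n choose (p + 1))) * 2 ^ (k - n) \<in> Hset (k + m) k"
proof -
  define a where "a = (\<lambda>j::nat. if j < p then -1 else if j < n then 1 else 0 :: real)"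
  define A where "A = (\<lambda>(i::nat) (j::nat). if i = 0 then a j else 0)"
  let ?N = "card {x \<in> cube k. \<forall>i<k + m - k. (\<Sum>j<k. A i j * x j) = 0 \<or> (\<Sum>j<k. A i j * x j) = 1}"
  have rows: "(\<forall>i<k + m - k. (\<Sum>j<k. A i j * x j) = 0 \<or> (\<Sum>j<k. A i j * x j) = 1)
      \<longleftrightarrow> (\<Sum>j<k. a j * x j) = 0 \<or> (\<Sum>j<k. a j * x j) = 1" for x
  proof -
    have "(\<Sum>j<k. A i j * x j) = (if i = 0 then \<Sum>j<k. a j * x j else 0)" for i
      by (simp add: A_def)
    then show ?thesis using assms(1) by auto
  qed
  define Q where "Q = (\<lambda>X. sum a X = 0 \<or> sum a X = 1)"
  have "{x \<in> cube k. \<forall>i<k + m - k. (\<Sum>j<k. A i j * x j) = 0 \<or> (\<Sum>j<k. A i j * x j) = 1}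
      = indicator_point ` {X \<in> Pow {..<k}. Q X}"
    unfolding rows cube_eq_image Q_def using sum_indicator_point[of _ k a] by auto
  then have "?N = card {X \<in> Pow {..<k}. Q X}"
    by (simp add: card_image inj_on_subset[OF inj_indicator_point])
  also have "real \<dots> = (\<Sum>X\<in>Pow {..<k}. of_bool (Q X))"
    by (simp add: Int_def flip: of_nat_sum)
  also have "\<dots> = 2 ^ k * prob_on {..<k} Q" by (simp add: avg_def)
  also have "prob_on {..<k} Q = prob_on {..<n} Q"
  proof (rule avg_local)
    fix X assume "X \<subseteq> {..<k}"
    then have "sum a X = sum a (X \<inter> {..<n})"
      using assms(3) by (intro sum.mono_neutral_right) (auto simp: a_def intro: finite_subset)
    then show "of_bool (Q X) = (of_bool (Q (X \<inter> {..<n})) :: real)" by (simp add: Q_def)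
  qed (use assms in auto)
  \<comment> \<open>The entries add up to \<open>n - 2 p\<close>, so the row values 0 and 1
    correspond to these two signed sums.\<close>
  also have "\<dots> = prob_on {..<n} (\<lambda>X. rsum {..<n} a X \<in> {2 * real p - real n, 2 * real (p + 1) - real n})"
  proof (intro avg_cong)
    fix X assume X: "X \<subseteq> {..<n}"
    have "sum a {..<n} = real n - 2 * real p"
    proof -
      have "{..<n} = {..<p} \<union> {p..<n}" using assms(3) by auto
      then have "sum a {..<n} = sum a {..<p} + sum a {p..<n}"
        by (simp add: sum.union_disjoint ivl_disj_int)
      also have "sum a {..<p} = - real p" by (simp add: a_def)
      also have "sum a {p..<n} = real (n - p)" by (simp add: a_def)
      finally show ?thesis using assms(3) by simp
    qed
    moreover have "rsum {..<n} a X = (\<Sum>j<n. 2 * (a j * indicator_point X j) - a j)"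
      unfolding rsum_def by (intro sum.cong) (auto simp: sg_def indicator_point_def)
    ultimately have "rsum {..<n} a X = 2 * sum a X - (real n - 2 * real p)"
      unfolding sum_subtractf sum_distrib_left[symmetric] sum_indicator_point[OF X] by simp
    then show "of_bool (Q X) = (of_bool (rsum {..<n} a X \<in> {2 * real p - real n, 2 * real (p + 1) - real n}) :: real)"
      by (auto simp: Q_def)
  qed
  also have "\<dots> = binavg n (\<lambda>s. of_bool (s \<in> {2 * real p - real n, 2 * real (p + 1) - real n}))"
    using avg_rsum_units[of "{..<n}" a "\<lambda>s. of_bool (s \<in> {2 * real p - real n, 2 * real (p + 1) - real n})"]
    by (simp add: a_def)
  also have "\<dots> = real ((n choose p) + (n choose (p + 1))) / 2 ^ n"
  proof -
    have "(\<Sum>i\<le>n. real (n choose i) * of_bool (2 * real i - real n \<in> {2 * real p - real n, 2 * real (p + 1) - real n}))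
        = (\<Sum>i\<in>{..n} \<inter> {p, p + 1}. real (n choose i))"
      unfolding sum.inter_restrict[OF finite_atMost] by (intro sum.cong) auto
    \<comment> \<open>For \<open>p = n\<close> the index \<open>p + 1\<close> is out of range, but
      its binomial coefficient is zero.\<close>
    also have "\<dots> = (\<Sum>i\<in>{p, p + 1}. real (n choose i))"
      by (intro sum.mono_neutral_left) (auto simp: not_le)
    finally show ?thesis by (simp add: binavg_def)
  qed
  also have "2 ^ k * (real ((n choose p) + (n choose (p + 1))) / 2 ^ n)
      = real (((n choose p) + (n choose (p + 1))) * 2 ^ (k - n))"
  proof -
    have "(2::real) ^ k = 2 ^ (k - n) * 2 ^ n" using assms(2) by (simp flip: power_add)
    then show ?thesis by simp
  qed
  finally have "?N = ((n choose p) + (n choose (p + 1))) * 2 ^ (k - n)"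
    by (simp only: of_nat_eq_iff)
  then show ?thesis
    unfolding Hset_def by (intro CollectI exI[of _ A]) simp
qed

theorem theorem1p2:
  fixes k m :: nat
  assumes "k \<ge> 8" and "m \<ge> 1"
  shows "Hset (k + m) k \<inter> {15 * 2^(k-1) div 16 .. 2^(k-1)}
           = {15 * 2^(k-1) div 16, 126 * 2^(k-1) div 128, 2^(k-1)}"
proof -
  \<comment> \<open>Since \<open>2 ^ (k - 1)\<close> is then a multiple of 128, the divisions by 16
    and 128 are exact.\<close>
  obtain e where k: "k = e + 8" using assms(1) by (metis add.commute le_Suc_ex)
  have vals: "15 * 2 ^ (k - 1) div 16 = (120 * 2 ^ e :: nat)" "126 * 2 ^ (k - 1) div 128 = (126 * 2 ^ e :: nat)"
    "2 ^ (k - 1) = (128 * 2 ^ e :: nat)"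
    by (simp_all add: k power_add)
  have gap: "N \<in> {120 * 2 ^ e, 126 * 2 ^ e, 128 * 2 ^ e}"
    if "N \<in> Hset (k + m) k" "120 * 2 ^ e \<le> N" "N \<le> 128 * 2 ^ e" for N
  proof -
    obtain A :: "nat \<Rightarrow> nat \<Rightarrow> real" where
      N: "N = card {x \<in> cube k. \<forall>i<k + m - k. (\<Sum>j<k. A i j * x j) = 0 \<or> (\<Sum>j<k. A i j * x j) = 1}"
      using \<open>N \<in> Hset (k + m) k\<close> unfolding Hset_def by blast
    define P where "P = prob_on {..k} (good {..k} ((\<lambda>i. hom_row k (A i)) ` {..<m}))"
    have NP: "real N = 256 * 2 ^ e * P"
      unfolding N P_def using card_cube_eq_prob[where A = A and k = k and m = m] by (simp add: k power_add)
    have "P \<le> 15/32 \<or> P = 63/128 \<or> P \<ge> 1/2"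
      unfolding P_def by (rule prob_good_gap) simp
    moreover have "real (120 * 2 ^ e) \<le> real N" "real N \<le> real (128 * 2 ^ e)"
      using that(2,3) by (simp_all only: of_nat_le_iff)
    then have "15/32 \<le> P" "P \<le> 1/2" unfolding NP by simp_all
    ultimately have "P = 15/32 \<or> P = 63/128 \<or> P = 1/2" by linarith
    then have "real N = real (120 * 2 ^ e) \<or> real N = real (126 * 2 ^ e) \<or> real N = real (128 * 2 ^ e)"
      unfolding NP by auto
    then show ?thesis unfolding of_nat_eq_iff by simp
  qed
  \<comment> \<open>One entry -1 and four entries 1, so that \<open>5 + 10 = 15\<close> of 32
    patterns are admissible.\<close>
  have mem120: "120 * 2 ^ e \<in> Hset (k + m) k"
  proof -
    have "(5 choose 1) + (5 choose (1 + 1)) = (15 :: nat)" by (simp add: eval_nat_numeral)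
    then show ?thesis
      using card_single_row_mem_Hset[OF assms(2), of 5 k 1] by (simp add: k power_add)
  qed
  \<comment> \<open>Four entries of each sign, so that \<open>70 + 56 = 126\<close> of 256 patterns
    are admissible.\<close>
  have mem126: "126 * 2 ^ e \<in> Hset (k + m) k"
  proof -
    have "(8 choose 4) + (8 choose (4 + 1)) = (126 :: nat)" by (simp add: eval_nat_numeral)
    then show ?thesis
      using card_single_row_mem_Hset[OF assms(2), of 8 k 4] by (simp add: k)
  qed
  \<comment> \<open>A single entry -1 forces one coordinate to be 0, which keeps half of the
    cube.\<close>
  have mem128: "128 * 2 ^ e \<in> Hset (k + m) k"
    using card_single_row_mem_Hset[OF assms(2), of 1 k 1] by (simp add: k power_add)
  show ?thesis
    \<comment> \<open>The quotients come first, because rewriting \<open>2 ^ (k - 1)\<close> would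
      destroy their left-hand sides.\<close>
    unfolding vals(1,2) unfolding vals(3)
  proof (intro equalityI subsetI)
    fix N assume "N \<in> Hset (k + m) k \<inter> {120 * 2 ^ e..128 * 2 ^ e}"
    then show "N \<in> {120 * 2 ^ e, 126 * 2 ^ e, 128 * 2 ^ e}" by (intro gap) simp_all
  qed (use mem120 mem126 mem128 in auto)
qed

end
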